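(* Let $(b,a)$ be a rational Pythagorean pair (that is, a Pythagorean pair with $b$ and $a$ rational functions), and let $\phi:=b/a$. (i) If $f\in H^2$ and $$\sum_{m\ge0}\Bigl|\sum_{n\ge0}\overline{\hat{\phi}(n)}\hat{f}(m+n)\Bigr|^2<\infty,\qquad( * )$$ then $f\in\mathcal{H}(b)$ and $$\|f\|_{\mathcal{H}(b)}^2=\sum_{m\ge0}|\hat{f}(m)|^2+\sum_{m\ge0}\Bigl|\sum_{n\ge0}\overline{\hat{\phi}(n)}\hat{f}(m+n)\Bigr|^2.\qquad( ** )$$ (ii) If all the poles of $\phi$ on $\mathbb{T}$ are simple, and if $f\in\mathcal{H}(b)$, then $( * )$ holds. (iii) If $\phi$ has a multiple pole on $\mathbb{T}$, then there exist $f\in\mathcal{H}(b)$ and $m\ge0$ such that the series $\sum_{n\ge0}\overline{\hat{\phi}(n)}\hat{f}(m+n)$ diverges, and consequently $( * )$ and $( ** )$ fail to hold for this $f$.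
   Context: $\mathbb{D}$ is the open unit disk, $\mathbb{T}$ the unit circle, and $H^p$ ($0<p\le\infty$) the Hardy spaces on $\mathbb{D}$. A Pythagorean pair is a pair $(b,a)$ of functions in $H^\infty$ such that $|b|^2+|a|^2=1$ a.e. on $\mathbb{T}$, $a$ is outer and $a(0)>0$. For $b\in H^\infty$ with $\|b\|_{H^\infty}\le1$, the de Branges--Rovnyak space $\mathcal{H}(b)$ is the Hilbert space of functions on $\mathbb{D}$ with reproducing kernel $(z,w)\mapsto (1-\overline{b(w)}b(z))/(1-\overline{w}z)$; it is contractively contained in $H^2$. For $f$ holomorphic on $\mathbb{D}$, $\hat{f}(n)$ denotes the $n$-th Taylor coefficient of $f$ at $0$. It is implicit in condition $( * )$ that each individual inner series $\sum_{n\ge0}\overline{\hat{\phi}(n)}\hat{f}(m+n)$, $m\ge0$, converges (not necessarily absolutely). *)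

theory Defs
  imports "HOL-Complex_Analysis.Complex_Analysis"
begin

text \<open>
  Functions on the unit disk are represented by functions \<open>complex \<Rightarrow> complex\<close>, whose values
  off the disk are irrelevant for membership in the spaces below.
\<close>

abbreviation unit_disk :: "complex set" where
  "unit_disk \<equiv> ball 0 1"

definition hardy :: "real \<Rightarrow> (complex \<Rightarrow> complex) set" where
  "hardy p = {f. f holomorphic_on unit_disk \<and>
     bdd_above ((\<lambda>r. (1 / (2 * pi)) *
       integral {0..2 * pi} (\<lambda>t. cmod (f (of_real r * cis t)) powr p)) ` {0..<1})}"

definition hardy_inf :: "(complex \<Rightarrow> complex) set" where
  "hardy_inf = {f. f holomorphic_on unit_disk \<and> bounded (f ` unit_disk)}"

definition radial_limit :: "(complex \<Rightarrow> complex) \<Rightarrow> complex \<Rightarrow> complex" where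
  "radial_limit f \<zeta> = Lim (at_left 1) (\<lambda>r::real. f (of_real r * \<zeta>))"

text \<open>
  \<open>\<psi>\<close> is positive everywhere, not just almost everywhere, only because \<open>ln 0 = 0\<close> here;
  changing \<open>\<psi>\<close> on a null set does not affect the integral.
\<close>

definition outer :: "(complex \<Rightarrow> complex) \<Rightarrow> bool" where
  "outer f \<longleftrightarrow> (\<exists>c (\<psi> :: real \<Rightarrow> real). cmod c = 1 \<and> (\<forall>t. \<psi> t > 0) \<and>
     set_integrable lborel {0..2 * pi} (\<lambda>t. ln (\<psi> t)) \<and>
     (\<forall>z\<in>unit_disk. f z = c * exp (of_real (1 / (2 * pi)) *
        (LINT t:{0..2 * pi}|lborel. (cis t + z) / (cis t - z) * of_real (ln (\<psi> t))))))"

text \<open>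
  The condition almost everywhere on the circle is stated for almost every real angle, which is
  the same by periodicity.
\<close>

definition pythagorean_pair :: "(complex \<Rightarrow> complex) \<Rightarrow> (complex \<Rightarrow> complex) \<Rightarrow> bool" where
  "pythagorean_pair b a \<longleftrightarrow> b \<in> hardy_inf \<and> a \<in> hardy_inf \<and>
     (AE t in lborel. (cmod (radial_limit b (cis t)))\<^sup>2 + (cmod (radial_limit a (cis t)))\<^sup>2 = 1) \<and>
     outer a \<and> a 0 \<in> \<real> \<and> Re (a 0) > 0"

text \<open>
  A rational function is defined on the whole plane; at the finitely many zeros of the chosen
  denominator its value is left open.
\<close>

definition rational_function :: "(complex \<Rightarrow> complex) \<Rightarrow> bool" where
  "rational_function r \<longleftrightarrow>
     (\<exists>p q. q \<noteq> 0 \<and> (\<forall>z. poly q z \<noteq> 0 \<longrightarrow> r z = poly p z / poly q z))"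

definition rational_pythagorean_pair ::
    "(complex \<Rightarrow> complex) \<Rightarrow> (complex \<Rightarrow> complex) \<Rightarrow> bool" where
  "rational_pythagorean_pair b a \<longleftrightarrow>
     pythagorean_pair b a \<and> rational_function b \<and> rational_function a"

definition taylor_coeff :: "(complex \<Rightarrow> complex) \<Rightarrow> nat \<Rightarrow> complex" where
  "taylor_coeff f n = (deriv ^^ n) f 0 / fact n"

definition ip_norm :: "(('a \<Rightarrow> complex) \<Rightarrow> ('a \<Rightarrow> complex) \<Rightarrow> complex) \<Rightarrow> ('a \<Rightarrow> complex) \<Rightarrow> real" where
  "ip_norm ip f = sqrt (Re (ip f f))"

text \<open>
  A Hilbert space of functions on \<open>X\<close>, consisting of total functions considered up to equality
  on \<open>X\<close>: the set \<open>H\<close> is closed under changes off \<open>X\<close>, and the vectors of norm zero are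
  exactly the functions vanishing on \<open>X\<close>. The inner product is linear in its first argument;
  its values outside \<open>H\<close> are irrelevant.
\<close>

locale hilbert_function_space =
  fixes X :: "'a set"
    and H :: "('a \<Rightarrow> complex) set"
    and ip :: "('a \<Rightarrow> complex) \<Rightarrow> ('a \<Rightarrow> complex) \<Rightarrow> complex"
  assumes cong_mem: "\<lbrakk>f \<in> H; \<And>x. x \<in> X \<Longrightarrow> g x = f x\<rbrakk> \<Longrightarrow> g \<in> H"
    and zero_mem: "(\<lambda>x. 0) \<in> H"
    and add_mem: "\<lbrakk>f \<in> H; g \<in> H\<rbrakk> \<Longrightarrow> (\<lambda>x. f x + g x) \<in> H"
    and scale_mem: "f \<in> H \<Longrightarrow> (\<lambda>x. c * f x) \<in> H"
    and ip_add: "\<lbrakk>f \<in> H; g \<in> H; h \<in> H\<rbrakk> \<Longrightarrow> ip (\<lambda>x. f x + g x) h = ip f h + ip g h"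
    and ip_scale: "\<lbrakk>f \<in> H; h \<in> H\<rbrakk> \<Longrightarrow> ip (\<lambda>x. c * f x) h = c * ip f h"
    and ip_cnj: "\<lbrakk>f \<in> H; g \<in> H\<rbrakk> \<Longrightarrow> ip g f = cnj (ip f g)"
    and ip_nonneg: "f \<in> H \<Longrightarrow> Re (ip f f) \<ge> 0"
    and ip_zero_iff: "f \<in> H \<Longrightarrow> ip f f = 0 \<longleftrightarrow> (\<forall>x\<in>X. f x = 0)"
    and complete: "\<lbrakk>\<And>n. F n \<in> H;
          \<forall>e>0. \<exists>N. \<forall>m\<ge>N. \<forall>n\<ge>N. ip_norm ip (\<lambda>x. F m x - F n x) < e\<rbrakk>
        \<Longrightarrow> \<exists>f\<in>H. (\<lambda>n::nat. ip_norm ip (\<lambda>x. F n x - f x)) \<longlonglongrightarrow> 0"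

locale rkhs = hilbert_function_space X H ip
  for X :: "'a set"
    and K :: "'a \<Rightarrow> 'a \<Rightarrow> complex"
    and H :: "('a \<Rightarrow> complex) set"
    and ip :: "('a \<Rightarrow> complex) \<Rightarrow> ('a \<Rightarrow> complex) \<Rightarrow> complex" +
  assumes kernel_mem: "w \<in> X \<Longrightarrow> (\<lambda>z. K z w) \<in> H"
    and reproducing: "\<lbrakk>f \<in> H; w \<in> X\<rbrakk> \<Longrightarrow> ip f (\<lambda>z. K z w) = f w"

definition dbr_kernel :: "(complex \<Rightarrow> complex) \<Rightarrow> complex \<Rightarrow> complex \<Rightarrow> complex" where
  "dbr_kernel b z w = (1 - cnj (b w) * b z) / (1 - cnj w * z)"

text \<open>
  A kernel determines its Hilbert space, both as a set of functions on \<open>X\<close> and in its norm, so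
  this predicate pins down the de Branges--Rovnyak space of \<open>b\<close>.
\<close>

definition is_dbr_space :: "(complex \<Rightarrow> complex) \<Rightarrow> (complex \<Rightarrow> complex) set \<Rightarrow>
    ((complex \<Rightarrow> complex) \<Rightarrow> (complex \<Rightarrow> complex) \<Rightarrow> complex) \<Rightarrow> bool" where
  "is_dbr_space b H ip \<longleftrightarrow> rkhs unit_disk (dbr_kernel b) H ip"

definition corr_term :: "(complex \<Rightarrow> complex) \<Rightarrow> (complex \<Rightarrow> complex) \<Rightarrow> nat \<Rightarrow> nat \<Rightarrow> complex" where
  "corr_term \<phi> f m n = cnj (taylor_coeff \<phi> n) * taylor_coeff f (m + n)"

text \<open>
  Convergence of the inner series is part of the condition; \<open>summable\<close> refers to the partial
  sums in the given order, so absolute convergence is not required.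
\<close>

definition corr_square_summable :: "(complex \<Rightarrow> complex) \<Rightarrow> (complex \<Rightarrow> complex) \<Rightarrow> bool" where
  "corr_square_summable \<phi> f \<longleftrightarrow>
     (\<forall>m. summable (corr_term \<phi> f m)) \<and>
     summable (\<lambda>m. (cmod (\<Sum>n. corr_term \<phi> f m n))\<^sup>2)"

text \<open>
  The norm formula includes the convergence of all series in it, since a divergent series would
  otherwise have an arbitrary value.
\<close>

definition corr_norm_formula :: "(complex \<Rightarrow> complex) \<Rightarrow>
    ((complex \<Rightarrow> complex) \<Rightarrow> (complex \<Rightarrow> complex) \<Rightarrow> complex) \<Rightarrow> (complex \<Rightarrow> complex) \<Rightarrow> bool" where
  "corr_norm_formula \<phi> ip f \<longleftrightarrow>
     summable (\<lambda>m. (cmod (taylor_coeff f m))\<^sup>2) \<and> corr_square_summable \<phi> f \<and>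
     (ip_norm ip f)\<^sup>2 = (\<Sum>m. (cmod (taylor_coeff f m))\<^sup>2)
                      + (\<Sum>m. (cmod (\<Sum>n. corr_term \<phi> f m n))\<^sup>2)"

end

theory Submission
  imports Defs "HOL-Computational_Algebra.Fundamental_Theorem_Algebra"
begin

text \<open>
  Write \<open>a = A / Q\<close> and \<open>b = B / Q\<close> with polynomials, where \<open>Q\<close> has no zero in the closed disk and
  \<open>A\<close> has none in the open disk. Let \<open>T\<^sub>p\<close> denote the Toeplitz operator on \<open>H\<^sup>2\<close> whose symbol is the
  conjugate of \<open>p\<close>. The space of all \<open>f\<close> for which some \<open>g\<close> in \<open>H\<^sup>2\<close> satisfies \<open>T\<^sub>B f = T\<^sub>A g\<close>, with
  norm squared \<open>\<parallel>f\<parallel>\<^sup>2 + \<parallel>g\<parallel>\<^sup>2\<close>, has the reproducing kernel of \<open>b\<close>, so it is the de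
  Branges--Rovnyak space. For polynomials \<open>T\<^sub>p\<close> is a finite combination of backward shifts, hence
  it can be moved through the conditionally convergent series, and \<open>A \<phi> = B\<close> yields (i). At a
  zero \<open>\<zeta>\<close> of \<open>A\<close> on the circle \<open>B\<close> does not vanish, so \<open>T\<^sub>B f = T\<^sub>A g\<close> puts \<open>f\<close> into the range of
  the operator \<open>T\<^sub>p\<close> with \<open>p = z - \<zeta>\<close>, and the series belonging to a simple pole telescopes; this
  is (ii). If \<open>\<phi>\<close> has a multiple pole, its coefficients are unbounded, and \<open>f = T\<^sub>A u\<close> with a lacunary
  \<open>u\<close> gives (iii).
\<close>

text \<open>The space is given only through its kernel, so the proof rests on the uniqueness of the
  Hilbert space with a given kernel, which allows an explicit model to replace \<open>H\<close>. The
  model has the right kernel for the following reason. On the circle |B|^2 + |A|^2 = |Q|^2, hence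
  T_B (B h) + T_A (A h) = T_Q (Q h) for every power series h. Take h = 1 / (Q (1 - conj(w) z)): then
  Q h is the Szego kernel at w, an eigenvector of T_B and T_Q, and the identity says that the kernel
  function of b at w has the partner g = conj(b(w)) A h. The norm formula is thereby reduced to the
  question whether the correlation sums are the coefficients of g. The obstacle is that these series
  may converge only conditionally, so infinite sums cannot simply be interchanged; multiplication by
  A leads back to polynomials, for which all sums are finite. In (iii), bounded coefficients would
  permit growth of order at most 1 / (1 - r) along a radius, which a multiple pole exceeds.\<close>

unbundle no vec_syntax

section \<open>Reproducing kernel Hilbert spaces\<close>

context hilbert_function_space
begin

lemma diff_mem: "f \<in> H \<Longrightarrow> g \<in> H \<Longrightarrow> (\<lambda>x. f x - g x) \<in> H"
  using add_mem[of f "\<lambda>x. (-1) * g x"] scale_mem[of g "-1"] by simp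

lemma ip_diff: "f \<in> H \<Longrightarrow> g \<in> H \<Longrightarrow> h \<in> H \<Longrightarrow> ip (\<lambda>x. f x - g x) h = ip f h - ip g h"
  using ip_add[of f "\<lambda>x. (-1) * g x" h] ip_scale[of g h "-1"] scale_mem[of g "-1"] by simp

lemma ip_add_right:
  assumes "f \<in> H" "g \<in> H" "h \<in> H"
  shows "ip h (\<lambda>x. f x + g x) = ip h f + ip h g"
proof -
  have "ip h (\<lambda>x. f x + g x) = cnj (ip (\<lambda>x. f x + g x) h)"
    using assms by (intro ip_cnj add_mem)
  also have "\<dots> = cnj (ip f h) + cnj (ip g h)"
    using assms by (simp add: ip_add)
  finally show ?thesis
    using assms ip_cnj[of f h] ip_cnj[of g h] by simp
qed

lemma ip_scale_right:
  assumes "f \<in> H" "h \<in> H"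
  shows "ip h (\<lambda>x. c * f x) = cnj c * ip h f"
proof -
  have "ip h (\<lambda>x. c * f x) = cnj (ip (\<lambda>x. c * f x) h)"
    using assms by (intro ip_cnj scale_mem)
  then show ?thesis
    using assms ip_cnj[of f h] by (simp add: ip_scale)
qed

lemma Im_ip_self: "f \<in> H \<Longrightarrow> Im (ip f f) = 0"
  using ip_cnj[of f f] by (metis add.inverse_inverse cnj.simps(2) equation_minus_iff neg_equal_zero)

lemma ip_self: "f \<in> H \<Longrightarrow> ip f f = of_real (Re (ip f f))"
  by (simp add: complex_eq_iff Im_ip_self)

lemma ip_norm_nonneg: "f \<in> H \<Longrightarrow> 0 \<le> ip_norm ip f"
  by (simp add: ip_norm_def ip_nonneg)

lemma ip_norm_sq: "f \<in> H \<Longrightarrow> (ip_norm ip f)\<^sup>2 = Re (ip f f)"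
  by (simp add: ip_norm_def ip_nonneg)

lemma ip_norm_zero_iff: "f \<in> H \<Longrightarrow> ip_norm ip f = 0 \<longleftrightarrow> (\<forall>x\<in>X. f x = 0)"
  using ip_zero_iff[of f] ip_self[of f] by (auto simp: ip_norm_def)

lemma ip_norm_add_sq:
  assumes "f \<in> H" "g \<in> H"
  shows "(ip_norm ip (\<lambda>x. f x + g x))\<^sup>2 =
    (ip_norm ip f)\<^sup>2 + (ip_norm ip g)\<^sup>2 + 2 * Re (ip f g)"
  using assms ip_cnj[of f g]
  by (simp add: ip_norm_sq add_mem ip_add ip_add_right)

lemma ip_norm_scale_sq:
  assumes "f \<in> H"
  shows "(ip_norm ip (\<lambda>x. c * f x))\<^sup>2 = (cmod c)\<^sup>2 * (ip_norm ip f)\<^sup>2"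
proof -
  have "ip (\<lambda>x. c * f x) (\<lambda>x. c * f x) = (c * cnj c) * ip f f"
    using assms by (simp add: ip_scale ip_scale_right scale_mem)
  also have "c * cnj c = of_real ((cmod c)\<^sup>2)"
    by (simp add: complex_norm_square del: of_real_power)
  finally show ?thesis
    using assms by (simp add: ip_norm_sq scale_mem del: of_real_power)
qed

lemma ip_norm_diff_sq:
  assumes "f \<in> H" "g \<in> H"
  shows "(ip_norm ip (\<lambda>x. f x - g x))\<^sup>2 =
    (ip_norm ip f)\<^sup>2 + (ip_norm ip g)\<^sup>2 - 2 * Re (ip f g)"
  using ip_norm_add_sq[OF assms(1) scale_mem[OF assms(2), of "-1"]]
    ip_norm_scale_sq[OF assms(2), of "-1"] ip_scale_right[OF assms(2,1), of "-1"] by simp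

lemma ip_norm_minus_commute:
  assumes "f \<in> H" "g \<in> H"
  shows "ip_norm ip (\<lambda>x. f x - g x) = ip_norm ip (\<lambda>x. g x - f x)"
proof -
  have "(ip_norm ip (\<lambda>x. f x - g x))\<^sup>2 = (ip_norm ip (\<lambda>x. g x - f x))\<^sup>2"
    using assms ip_cnj[of f g] by (simp add: ip_norm_diff_sq)
  then show ?thesis
    using assms ip_norm_nonneg diff_mem by (simp add: power2_eq_iff_nonneg)
qed

text \<open>The quadratic in \<open>t\<close> is the squared norm of
  \<open>f - t * ip f g * g\<close>. If \<open>g\<close> has norm zero it degenerates to a linear
  function of \<open>t\<close>, which can stay nonnegative only if it is constant.\<close>

lemma Cauchy_Schwarz_sq:
  assumes "f \<in> H" "g \<in> H"
  shows "(cmod (ip f g))\<^sup>2 \<le> (ip_norm ip f)\<^sup>2 * (ip_norm ip g)\<^sup>2"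
proof -
  have *: "0 \<le> (ip_norm ip f)\<^sup>2 + (cmod (ip f g))\<^sup>2 * (t\<^sup>2 * (ip_norm ip g)\<^sup>2 - 2 * t)" for t :: real
  proof -
    let ?c = "of_real t * ip f g"
    have "ip f (\<lambda>x. ?c * g x) = of_real (t * (cmod (ip f g))\<^sup>2)"
      using ip_scale_right[OF assms(2,1), of ?c] complex_norm_square[of "ip f g"]
      by (simp add: mult_ac)
    then have "(ip_norm ip (\<lambda>x. f x - ?c * g x))\<^sup>2
        = (ip_norm ip f)\<^sup>2 + (cmod (ip f g))\<^sup>2 * (t\<^sup>2 * (ip_norm ip g)\<^sup>2 - 2 * t)"
      unfolding ip_norm_diff_sq[OF assms(1) scale_mem[OF assms(2)]] ip_norm_scale_sq[OF assms(2)]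
      by (simp add: norm_mult power_mult_distrib algebra_simps del: of_real_mult of_real_power)
    then show ?thesis
      by (metis zero_le_power2)
  qed
  show ?thesis
  proof (cases "ip_norm ip g = 0")
    case True
    show ?thesis
    proof (rule ccontr)
      assume "\<not> ?thesis"
      then have pos: "(cmod (ip f g))\<^sup>2 > 0"
        using True by simp
      \<comment> \<open>This \<open>t\<close> gives the linear function the value minus the squared
        norm of \<open>f\<close>, minus 2.\<close>
      have "(ip_norm ip f)\<^sup>2 + 2 \<le> 0"
        using *[of "((ip_norm ip f)\<^sup>2 + 1) / (cmod (ip f g))\<^sup>2"] True pos by simp
      then show False
        using zero_le_power2[of "ip_norm ip f"] by linarith
    qed
  next
    case False
    define \<kappa> where "\<kappa> = (ip_norm ip g)\<^sup>2"
    have \<kappa>: "\<kappa> > 0"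
      using False by (simp add: \<kappa>_def)
    \<comment> \<open>The quadratic \<open>t^2 * \<kappa> - 2 * t\<close> takes its minimum at
      \<open>1 / \<kappa>\<close>.\<close>
    have "(1 / \<kappa>)\<^sup>2 * \<kappa> - 2 * (1 / \<kappa>) = - (1 / \<kappa>)"
      using \<kappa> by (simp add: power2_eq_square)
    then have "(cmod (ip f g))\<^sup>2 / \<kappa> \<le> (ip_norm ip f)\<^sup>2"
      using *[of "1 / \<kappa>"] by (simp add: \<kappa>_def)
    then show ?thesis
      using \<kappa> by (simp add: pos_divide_le_eq \<kappa>_def)
  qed
qed

lemma Cauchy_Schwarz:
  assumes "f \<in> H" "g \<in> H"
  shows "cmod (ip f g) \<le> ip_norm ip f * ip_norm ip g"
  by (rule power2_le_imp_le)
    (use Cauchy_Schwarz_sq[OF assms] assms in \<open>auto simp: power_mult_distrib ip_norm_nonneg\<close>)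

lemma ip_norm_triangle:
  assumes "f \<in> H" "g \<in> H"
  shows "ip_norm ip (\<lambda>x. f x + g x) \<le> ip_norm ip f + ip_norm ip g"
proof (rule power2_le_imp_le)
  have "Re (ip f g) \<le> ip_norm ip f * ip_norm ip g"
    using Cauchy_Schwarz[OF assms] complex_Re_le_cmod[of "ip f g"] by linarith
  then show "(ip_norm ip (\<lambda>x. f x + g x))\<^sup>2 \<le> (ip_norm ip f + ip_norm ip g)\<^sup>2"
    using assms by (simp add: ip_norm_add_sq power2_sum)
qed (use assms in \<open>simp add: ip_norm_nonneg\<close>)

text \<open>The difference of \<open>g\<close> and \<open>f\<close> vanishes on \<open>X\<close>, so
  it has norm zero and Cauchy-Schwarz annihilates its inner products.\<close>

lemma ip_cong_left:
  assumes "f \<in> H" "h \<in> H" "\<And>x. x \<in> X \<Longrightarrow> g x = f x"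
  shows "ip g h = ip f h"
proof -
  have g: "g \<in> H"
    using cong_mem assms by blast
  have "ip_norm ip (\<lambda>x. g x - f x) = 0"
    using assms g by (subst ip_norm_zero_iff) (auto intro: diff_mem)
  then have "cmod (ip (\<lambda>x. g x - f x) h) \<le> 0"
    using Cauchy_Schwarz[OF diff_mem[OF g assms(1)] assms(2)] by simp
  then show ?thesis
    using assms g by (simp add: ip_diff)
qed

lemma ip_norm_cong:
  assumes "f \<in> H" "\<And>x. x \<in> X \<Longrightarrow> g x = f x"
  shows "ip_norm ip g = ip_norm ip f"
proof -
  have g: "g \<in> H"
    using cong_mem assms by blast
  have "ip g g = ip f g"
    using ip_cong_left assms g by blast
  also have "\<dots> = cnj (ip g f)"
    using ip_cnj assms g by blast
  also have "ip g f = ip f f"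
    using ip_cong_left assms by blast
  finally show ?thesis
    by (simp add: ip_norm_def)
qed

lemma ip_norm_tendsto:
  assumes "\<And>n::nat. F n \<in> H" "f \<in> H" "(\<lambda>n. ip_norm ip (\<lambda>x. F n x - f x)) \<longlonglongrightarrow> 0"
  shows "(\<lambda>n. ip_norm ip (F n)) \<longlonglongrightarrow> ip_norm ip f"
proof -
  have "\<bar>ip_norm ip (F n) - ip_norm ip f\<bar> \<le> ip_norm ip (\<lambda>x. F n x - f x)" for n
    using ip_norm_triangle[of "\<lambda>x. F n x - f x" f] ip_norm_triangle[of "\<lambda>x. f x - F n x" "F n"]
      assms ip_norm_minus_commute[of "F n" f] by (simp add: diff_mem)
  then have "(\<lambda>n. ip_norm ip (F n) - ip_norm ip f) \<longlonglongrightarrow> 0"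
    by (intro tendsto_0_le[OF assms(3), where K = 1] always_eventually)
      (auto intro: order_trans[OF _ abs_ge_self])
  then show ?thesis
    by (simp add: LIM_zero_iff)
qed

lemma convergent_imp_Cauchy:
  assumes "\<And>n::nat. F n \<in> H" "f \<in> H" "(\<lambda>n. ip_norm ip (\<lambda>x. F n x - f x)) \<longlonglongrightarrow> 0"
  shows "\<forall>e>0. \<exists>N. \<forall>m\<ge>N. \<forall>n\<ge>N. ip_norm ip (\<lambda>x. F m x - F n x) < e"
proof safe
  fix e :: real
  assume "e > 0"
  then obtain N where N: "\<And>n. n \<ge> N \<Longrightarrow> ip_norm ip (\<lambda>x. F n x - f x) < e / 2"
    using assms order_tendstoD(2)[OF assms(3), of "e / 2"]
    by (auto simp: eventually_sequentially)
  have "ip_norm ip (\<lambda>x. F m x - F n x) < e" if "m \<ge> N" "n \<ge> N" for m n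
    using ip_norm_triangle[of "\<lambda>x. F m x - f x" "\<lambda>x. f x - F n x"] assms(1,2)
      ip_norm_minus_commute[of "F n" f] N[OF that(1)] N[OF that(2)] by (simp add: diff_mem)
  then show "\<exists>N. \<forall>m\<ge>N. \<forall>n\<ge>N. ip_norm ip (\<lambda>x. F m x - F n x) < e"
    by blast
qed

end

section \<open>Density of the kernel functions and uniqueness of the space\<close>

context rkhs
begin

text \<open>The span is generated from \<open>X\<close> and \<open>K\<close> alone, without
  \<open>H\<close> and \<open>ip\<close>, so two spaces with the same kernel literally share it and
  its induction rule serves both.\<close>

inductive_set kernel_span :: "('a \<Rightarrow> complex) set" where
  zero: "(\<lambda>x. 0) \<in> kernel_span"
| add_kernel: "f \<in> kernel_span \<Longrightarrow> w \<in> X \<Longrightarrow> (\<lambda>z. f z + c * K z w) \<in> kernel_span"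

lemma kernel_span_mem: "f \<in> kernel_span \<Longrightarrow> f \<in> H"
  by (induction rule: kernel_span.induct) (auto intro!: zero_mem add_mem scale_mem kernel_mem)

lemma kernel_span_add: "g \<in> kernel_span \<Longrightarrow> f \<in> kernel_span \<Longrightarrow> (\<lambda>z. f z + g z) \<in> kernel_span"
proof (induction rule: kernel_span.induct)
  case (add_kernel g w c)
  then show ?case
    using kernel_span.add_kernel[of "\<lambda>z. f z + g z" w c] by (simp add: add.assoc)
qed simp

lemma kernel_span_scale: "f \<in> kernel_span \<Longrightarrow> (\<lambda>z. d * f z) \<in> kernel_span"
proof (induction rule: kernel_span.induct)
  case (add_kernel f w c)
  then show ?case
    using kernel_span.add_kernel[of "\<lambda>z. d * f z" w "d * c"] by (simp add: algebra_simps)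
qed (use kernel_span.zero in simp)

lemma kernel_span_diff: "f \<in> kernel_span \<Longrightarrow> g \<in> kernel_span \<Longrightarrow> (\<lambda>z. f z - g z) \<in> kernel_span"
  using kernel_span_add[of "\<lambda>z. (-1) * g z" f] kernel_span_scale[of g "-1"] by simp

lemma norm_apply_le:
  assumes "f \<in> H" "w \<in> X"
  shows "cmod (f w) \<le> ip_norm ip f * ip_norm ip (\<lambda>z. K z w)"
  using Cauchy_Schwarz[OF assms(1) kernel_mem[OF assms(2)]] reproducing[OF assms] by simp

lemma apply_tendsto:
  assumes "\<And>n::nat. F n \<in> H" "f \<in> H" "(\<lambda>n. ip_norm ip (\<lambda>x. F n x - f x)) \<longlonglongrightarrow> 0" "w \<in> X"
  shows "(\<lambda>n. F n w) \<longlonglongrightarrow> f w"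
proof -
  have "(\<lambda>n. F n w - f w) \<longlonglongrightarrow> 0"
    using norm_apply_le[OF diff_mem[OF assms(1,2)] assms(4)] assms
    by (intro tendsto_0_le[OF assms(3), where K = "ip_norm ip (\<lambda>z. K z w)"] always_eventually)
      (auto simp: ip_norm_nonneg diff_mem)
  then show ?thesis
    by (simp add: LIM_zero_iff)
qed

text \<open>
  The approximants form a minimizing sequence for the distance from \<open>f\<close> to the span; their
  limit differs from \<open>f\<close> by a vector orthogonal to all kernels, which vanishes on \<open>X\<close>.
\<close>

lemma kernel_span_dense:
  assumes f: "f \<in> H"
  obtains s :: "nat \<Rightarrow> 'a \<Rightarrow> complex"
  where "\<And>n. s n \<in> kernel_span" "(\<lambda>n. ip_norm ip (\<lambda>x. s n x - f x)) \<longlonglongrightarrow> 0"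
proof -
  define D where "D s = (ip_norm ip (\<lambda>x. f x - s x))\<^sup>2" for s
  define d where "d = Inf (D ` kernel_span)"
  have bdd: "bdd_below (D ` kernel_span)"
    by (rule bdd_belowI[of _ 0]) (auto simp: D_def)
  have d_le: "d \<le> D s" if "s \<in> kernel_span" for s
    unfolding d_def using bdd that by (simp add: cINF_lower)
  have "\<exists>s\<in>kernel_span. D s < d + 1 / real (Suc n)" for n
    using cInf_lessD[of "D ` kernel_span" "d + 1 / real (Suc n)"] kernel_span.zero
    unfolding d_def by fastforce
  then obtain s where s: "\<And>n. s n \<in> kernel_span" "\<And>n. D (s n) < d + 1 / real (Suc n)"
    by metis
  note sH = s(1)[THEN kernel_span_mem]
  \<comment> \<open>The midpoint of two approximants lies in the span again, hence is at squared
    distance at least \<open>d\<close> from \<open>f\<close>; the parallelogram law then forces the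
    approximants together.\<close>
  have parallelogram: "(ip_norm ip (\<lambda>x. s m x - s n x))\<^sup>2 \<le> 2 / real (Suc m) + 2 / real (Suc n)" for m n
  proof -
    let ?h = "\<lambda>x. (1 / 2) * (s m x + s n x)"
    have h: "?h \<in> kernel_span"
      using kernel_span_add kernel_span_scale s(1) by blast
    let ?u = "\<lambda>x. f x - s m x" and ?v = "\<lambda>x. f x - s n x"
    have u: "?u \<in> H" and v: "?v \<in> H"
      using diff_mem f sH by auto
    have "(ip_norm ip (\<lambda>x. ?v x - ?u x))\<^sup>2 + (ip_norm ip (\<lambda>x. ?v x + ?u x))\<^sup>2
        = 2 * D (s m) + 2 * D (s n)"
      unfolding D_def ip_norm_diff_sq[OF v u] ip_norm_add_sq[OF v u] by simp
    moreover have "(\<lambda>x. ?v x - ?u x) = (\<lambda>x. s m x - s n x)"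
      by auto
    moreover have "(\<lambda>x. ?v x + ?u x) = (\<lambda>x. 2 * (f x - ?h x))"
      by (auto simp: algebra_simps)
    moreover have "(ip_norm ip (\<lambda>x. 2 * (f x - ?h x)))\<^sup>2 = 4 * D ?h"
      unfolding D_def by (subst ip_norm_scale_sq) (use diff_mem f h kernel_span_mem in auto)
    ultimately have "(ip_norm ip (\<lambda>x. s m x - s n x))\<^sup>2 + 4 * D ?h = 2 * D (s m) + 2 * D (s n)"
      by simp
    moreover have "2 / real (Suc k) = 2 * (1 / real (Suc k))" for k
      by simp
    ultimately show ?thesis
      using d_le[OF h] s(2)[of m] s(2)[of n] by linarith
  qed
  have "\<forall>e>0. \<exists>N. \<forall>m\<ge>N. \<forall>n\<ge>N. ip_norm ip (\<lambda>x. s m x - s n x) < e"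
  proof safe
    fix e :: real
    assume e: "e > 0"
    then obtain N where N: "inverse (real (Suc N)) < e\<^sup>2 / 4"
      using reals_Archimedean[of "e\<^sup>2 / 4"] by auto
    have "ip_norm ip (\<lambda>x. s m x - s n x) < e" if "m \<ge> N" "n \<ge> N" for m n
    proof (rule power2_less_imp_less)
      have "2 / real (Suc m) \<le> 2 / real (Suc N)" "2 / real (Suc n) \<le> 2 / real (Suc N)"
        using that by (auto intro!: divide_left_mono)
      moreover have "4 / real (Suc N) < e\<^sup>2"
        using N by (simp add: field_simps)
      ultimately show "(ip_norm ip (\<lambda>x. s m x - s n x))\<^sup>2 < e\<^sup>2"
        using parallelogram[of m n] by simp
    qed (use e in simp)
    then show "\<exists>N. \<forall>m\<ge>N. \<forall>n\<ge>N. ip_norm ip (\<lambda>x. s m x - s n x) < e"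
      by blast
  qed
  then obtain g where g: "g \<in> H" "(\<lambda>n. ip_norm ip (\<lambda>x. s n x - g x)) \<longlonglongrightarrow> 0"
    using complete[of s] sH by blast
  have "g w = f w" if w: "w \<in> X" for w
  proof -
    let ?k = "\<lambda>z. K z w"
    have k: "?k \<in> H"
      using kernel_mem w by blast
    \<comment> \<open>Moving \<open>s n\<close> along the kernel at \<open>w\<close> cannot bring
      the squared distance below \<open>d\<close>, and \<open>s n\<close> is within
      \<open>1 / Suc n\<close> of it. So the component of \<open>f - s n\<close> along this kernel
      is small.\<close>
    have bound: "(cmod (f w - s n w))\<^sup>2 \<le> (ip_norm ip ?k)\<^sup>2 * (1 / real (Suc n))" for n
    proof (cases "ip_norm ip ?k = 0")
      case True
      then show ?thesis
        using norm_apply_le[OF diff_mem[OF f sH] w, of n] by simp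
    next
      case False
      define u where "u = (\<lambda>x. f x - s n x)"
      define \<kappa> where "\<kappa> = (ip_norm ip ?k)\<^sup>2"
      \<comment> \<open>\<open>c\<close> is the coefficient of the orthogonal projection of
        \<open>u\<close> onto the kernel at \<open>w\<close>; subtracting it lowers the squared norm
        by \<open>(cmod (u w))^2 / \<kappa>\<close>.\<close>
      define c where "c = u w / of_real \<kappa>"
      have \<kappa>: "\<kappa> > 0"
        using False by (simp add: \<kappa>_def)
      have u: "u \<in> H"
        using diff_mem f sH unfolding u_def by auto
      have "d \<le> D (\<lambda>z. s n z + c * ?k z)"
        using d_le kernel_span.add_kernel[OF s(1) w] by blast
      also have "\<dots> = (ip_norm ip (\<lambda>x. u x - c * ?k x))\<^sup>2"
        by (simp add: D_def u_def algebra_simps)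
      also have "\<dots> = D (s n) + (cmod c)\<^sup>2 * \<kappa> - 2 * Re (ip u (\<lambda>x. c * ?k x))"
        using u k by (simp add: ip_norm_diff_sq scale_mem ip_norm_scale_sq D_def u_def \<kappa>_def)
      also have "ip u (\<lambda>x. c * ?k x) = of_real ((cmod (u w))\<^sup>2 / \<kappa>)"
        using complex_norm_square[of "u w"] \<kappa>
        unfolding ip_scale_right[OF k u] reproducing[OF u w] by (simp add: c_def)
      also have "(cmod c)\<^sup>2 * \<kappa> = (cmod (u w))\<^sup>2 / \<kappa>"
        using \<kappa> by (simp add: c_def norm_divide power_divide power2_eq_square)
      finally have "(cmod (u w))\<^sup>2 / \<kappa> \<le> 1 / real (Suc n)"
        using s(2)[of n] by simp
      then show ?thesis
        using \<kappa> by (simp add: u_def \<kappa>_def field_simps)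
    qed
    have "(\<lambda>n. (cmod (f w - s n w))\<^sup>2) \<longlonglongrightarrow> 0"
    proof (rule tendsto_sandwich[OF _ _ tendsto_const])
      show "(\<lambda>n. (ip_norm ip ?k)\<^sup>2 * (1 / real (Suc n))) \<longlonglongrightarrow> 0"
        using tendsto_mult_right_zero[OF LIMSEQ_inverse_real_of_nat] by (simp add: inverse_eq_divide)
    qed (use bound in auto)
    then have "(\<lambda>n. f w - s n w) \<longlonglongrightarrow> 0"
      by (simp add: tendsto_norm_zero_iff)
    moreover have "(\<lambda>n. f w - s n w) \<longlonglongrightarrow> f w - g w"
      by (intro tendsto_intros apply_tendsto[OF sH g w])
    ultimately show "g w = f w"
      using LIMSEQ_unique by fastforce
  qed
  then have "ip_norm ip (\<lambda>x. s n x - f x) = ip_norm ip (\<lambda>x. s n x - g x)" for n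
    by (intro ip_norm_cong) (use diff_mem sH g in auto)
  then show ?thesis
    using that[of s] s(1) g(2) by simp
qed

end

text \<open>Against a kernel function the inner product is a point evaluation, which does not depend
  on the space.\<close>

lemma kernel_span_ip_unique:
  assumes 1: "rkhs X K H ip" and 2: "rkhs X K H' ip'"
    and f: "f \<in> rkhs.kernel_span X K" and g: "g \<in> rkhs.kernel_span X K"
  shows "ip f g = ip' f g"
  using g
proof (induction rule: rkhs.kernel_span.induct[OF 1, consumes 1])
  interpret A: rkhs X K H ip by fact
  interpret B: rkhs X K H' ip' by fact
  note fA = A.kernel_span_mem[OF f] and fB = B.kernel_span_mem[OF f]
  {
    case 1
    then show ?case
      using A.ip_scale_right[of f f 0] B.ip_scale_right[of f f 0] fA fB by simp
  next
    case (2 g w c)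
    then show ?case
      by (simp add: A.ip_add_right B.ip_add_right A.ip_scale_right B.ip_scale_right
          A.scale_mem B.scale_mem A.kernel_mem B.kernel_mem A.kernel_span_mem B.kernel_span_mem
          fA fB A.reproducing B.reproducing)
  }
qed

text \<open>Approximants of \<open>f\<close> from the span are Cauchy in both norms, because these
  agree on the span. Their limits agree on \<open>X\<close>, since norm convergence implies
  pointwise convergence in either space.\<close>

lemma rkhs_unique:
  assumes 1: "rkhs X K H ip" and 2: "rkhs X K H' ip'" and f: "f \<in> H"
  shows "f \<in> H' \<and> ip_norm ip' f = ip_norm ip f"
proof -
  interpret A: rkhs X K H ip by fact
  interpret B: rkhs X K H' ip' by fact
  obtain s :: "nat \<Rightarrow> _"
    where s: "\<And>n. s n \<in> A.kernel_span" "(\<lambda>n. ip_norm ip (\<lambda>x. s n x - f x)) \<longlonglongrightarrow> 0"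
    using A.kernel_span_dense[OF f] by blast
  note sA = A.kernel_span_mem[OF s(1)] and sB = B.kernel_span_mem[OF s(1)]
  have norm_eq: "ip_norm ip' t = ip_norm ip t" if "t \<in> A.kernel_span" for t
    using kernel_span_ip_unique[OF 1 2 that that] by (simp add: ip_norm_def)
  have "\<forall>e>0. \<exists>N. \<forall>m\<ge>N. \<forall>n\<ge>N. ip_norm ip' (\<lambda>x. s m x - s n x) < e"
    using A.convergent_imp_Cauchy[OF sA f s(2)] by (simp add: norm_eq A.kernel_span_diff s(1))
  then obtain g where g: "g \<in> H'" "(\<lambda>n. ip_norm ip' (\<lambda>x. s n x - g x)) \<longlonglongrightarrow> 0"
    using B.complete[of s] sB by blast
  have fg: "f x = g x" if "x \<in> X" for x
    using A.apply_tendsto[OF sA f s(2) that] B.apply_tendsto[OF sB g that] LIMSEQ_unique by blast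
  have "(\<lambda>n. ip_norm ip (s n)) \<longlonglongrightarrow> ip_norm ip f"
    using A.ip_norm_tendsto[OF sA f s(2)] .
  moreover have "(\<lambda>n. ip_norm ip (s n)) \<longlonglongrightarrow> ip_norm ip' g"
    using B.ip_norm_tendsto[OF sB g] by (simp add: norm_eq s(1))
  ultimately show ?thesis
    using LIMSEQ_unique B.cong_mem[OF g(1) fg] B.ip_norm_cong[OF g(1) fg] by metis
qed

section \<open>Square summable power series\<close>

text \<open>\<open>H^2\<close> is treated through Taylor coefficients. On formal series,
  multiplication by polynomials and the backward shift are algebraic, and no boundary values are
  involved.\<close>

definition l2_fps :: "complex fps \<Rightarrow> bool" where
  "l2_fps F \<longleftrightarrow> summable (\<lambda>n. (cmod (F $ n))\<^sup>2)"

definition l2_ip :: "complex fps \<Rightarrow> complex fps \<Rightarrow> complex" where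
  "l2_ip F G = (\<Sum>n. F $ n * cnj (G $ n))"

definition l2_sq :: "complex fps \<Rightarrow> real" where
  "l2_sq F = (\<Sum>n. (cmod (F $ n))\<^sup>2)"

lemma l2_fps_prod_summable:
  assumes "l2_fps F" "l2_fps G"
  shows "summable (\<lambda>n. F $ n * cnj (G $ n))"
proof (rule summable_comparison_test')
  show "summable (\<lambda>n. (cmod (F $ n))\<^sup>2 + (cmod (G $ n))\<^sup>2)"
    using assms unfolding l2_fps_def by (rule summable_add)
  show "norm (F $ n * cnj (G $ n)) \<le> (cmod (F $ n))\<^sup>2 + (cmod (G $ n))\<^sup>2" for n
    using sum_squares_bound[of "cmod (F $ n)" "cmod (G $ n)"]
      mult_nonneg_nonneg[OF norm_ge_zero[of "F $ n"] norm_ge_zero[of "G $ n"]]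
    unfolding norm_mult complex_mod_cnj by linarith
qed

lemma l2_fps_0 [simp]: "l2_fps 0"
  by (simp add: l2_fps_def)

lemma l2_fps_add:
  assumes "l2_fps F" "l2_fps G"
  shows "l2_fps (F + G)"
  unfolding l2_fps_def
proof (rule summable_comparison_test')
  show "summable (\<lambda>n. 2 * ((cmod (F $ n))\<^sup>2 + (cmod (G $ n))\<^sup>2))"
    using assms unfolding l2_fps_def by (intro summable_mult summable_add)
  show "norm ((cmod ((F + G) $ n))\<^sup>2) \<le> 2 * ((cmod (F $ n))\<^sup>2 + (cmod (G $ n))\<^sup>2)" for n
  proof -
    have "(cmod ((F + G) $ n))\<^sup>2 \<le> (cmod (F $ n) + cmod (G $ n))\<^sup>2"
      by (simp add: norm_triangle_ineq power_mono)
    then show ?thesis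
      using sum_squares_bound[of "cmod (F $ n)" "cmod (G $ n)"] by (simp add: power2_sum)
  qed
qed

lemma l2_fps_const_mult: "l2_fps F \<Longrightarrow> l2_fps (fps_const c * F)"
  by (simp add: l2_fps_def norm_mult power_mult_distrib summable_mult)

lemma l2_fps_diff: "l2_fps F \<Longrightarrow> l2_fps G \<Longrightarrow> l2_fps (F - G)"
  using l2_fps_add[of F "fps_const (-1) * G"] l2_fps_const_mult[of G "-1"]
  by (simp flip: fps_const_neg)

lemma l2_fps_shift: "l2_fps F \<Longrightarrow> l2_fps (fps_shift k F)"
  unfolding l2_fps_def fps_shift_nth by (rule summable_ignore_initial_segment)

lemma l2_fps_X_mult: "l2_fps F \<Longrightarrow> l2_fps (fps_X * F)"
  unfolding l2_fps_def by (subst summable_Suc_iff[symmetric]) simp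

lemma l2_fps_poly_mult: "l2_fps F \<Longrightarrow> l2_fps (fps_of_poly p * F)"
proof (induction p)
  case (pCons a p)
  have "fps_of_poly (pCons a p) * F = fps_const a * F + fps_X * (fps_of_poly p * F)"
    by (simp add: fps_of_poly_pCons algebra_simps)
  then show ?case
    using pCons by (simp add: l2_fps_add l2_fps_const_mult l2_fps_X_mult)
qed simp

lemma l2_fps_tendsto_0: "l2_fps F \<Longrightarrow> (\<lambda>n. F $ n) \<longlonglongrightarrow> 0"
  using summable_LIMSEQ_zero[of "\<lambda>n. (cmod (F $ n))\<^sup>2"] unfolding l2_fps_def
  by (simp add: tendsto_norm_zero_iff)

lemma l2_sq_nonneg: "l2_fps F \<Longrightarrow> 0 \<le> l2_sq F"
  unfolding l2_fps_def l2_sq_def by (rule suminf_nonneg) auto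

lemma nth_le_l2_sq: "l2_fps F \<Longrightarrow> (cmod (F $ n))\<^sup>2 \<le> l2_sq F"
  using sum_le_suminf[of "\<lambda>n. (cmod (F $ n))\<^sup>2" "{n}"] by (simp add: l2_fps_def l2_sq_def)

lemma l2_sq_eq_0_iff: "l2_fps F \<Longrightarrow> l2_sq F = 0 \<longleftrightarrow> F = 0"
  using nth_le_l2_sq[of F] by (auto simp: fps_eq_iff l2_sq_def)

lemma l2_ip_self: "l2_fps F \<Longrightarrow> l2_ip F F = of_real (l2_sq F)"
  unfolding l2_ip_def l2_sq_def l2_fps_def
  by (simp add: suminf_of_real flip: complex_norm_square)

lemma l2_ip_add_left: "l2_fps F \<Longrightarrow> l2_fps G \<Longrightarrow> l2_fps H \<Longrightarrow> l2_ip (F + G) H = l2_ip F H + l2_ip G H"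
  unfolding l2_ip_def
  by (subst suminf_add) (auto intro: l2_fps_prod_summable simp: algebra_simps)

lemma l2_ip_const_left: "l2_fps F \<Longrightarrow> l2_fps H \<Longrightarrow> l2_ip (fps_const c * F) H = c * l2_ip F H"
  unfolding l2_ip_def
  by (subst suminf_mult[symmetric]) (auto intro: l2_fps_prod_summable simp: mult_ac)

lemma l2_ip_cnj: "l2_fps F \<Longrightarrow> l2_fps G \<Longrightarrow> l2_ip G F = cnj (l2_ip F G)"
  unfolding l2_ip_def
  using sums_unique[OF sums_cnj[THEN iffD2, OF summable_sums[OF l2_fps_prod_summable[of F G]]]]
  by (simp add: mult_ac)

lemma l2_ip_add_right: "l2_fps F \<Longrightarrow> l2_fps G \<Longrightarrow> l2_fps H \<Longrightarrow> l2_ip H (F + G) = l2_ip H F + l2_ip H G"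
  using l2_ip_cnj[of "F + G" H] l2_ip_cnj[of F H] l2_ip_cnj[of G H]
  by (simp add: l2_ip_add_left l2_fps_add)

lemma l2_ip_const_right: "l2_fps F \<Longrightarrow> l2_fps H \<Longrightarrow> l2_ip H (fps_const c * F) = cnj c * l2_ip H F"
  using l2_ip_cnj[of "fps_const c * F" H] l2_ip_cnj[of F H]
  by (simp add: l2_ip_const_left l2_fps_const_mult)

lemma l2_ip_diff_right: "l2_fps F \<Longrightarrow> l2_fps G \<Longrightarrow> l2_fps H \<Longrightarrow> l2_ip H (F - G) = l2_ip H F - l2_ip H G"
  using l2_ip_add_right[of F "fps_const (-1) * G" H] l2_ip_const_right[of G H "-1"]
    l2_fps_const_mult[of G "-1"]
  by (simp flip: fps_const_neg)

lemma l2_ip_X_mult: "l2_fps F \<Longrightarrow> l2_fps G \<Longrightarrow> l2_ip F (fps_X * G) = l2_ip (fps_shift 1 F) G"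
  using suminf_split_head[OF l2_fps_prod_summable[of F "fps_X * G"]]
  by (simp add: l2_ip_def l2_fps_X_mult)

text \<open>The limit is taken coefficientwise, and bounds for finite partial sums pass to it. The
  convergence of each coefficient is kept in the conclusion because relations between finitely many
  coefficients are later carried to the limit.\<close>

lemma l2_fps_Cauchy_limit:
  fixes F :: "nat \<Rightarrow> complex fps"
  assumes l2: "\<And>k. l2_fps (F k)"
    and Cauchy: "\<forall>e>0. \<exists>N. \<forall>m\<ge>N. \<forall>n\<ge>N. l2_sq (F m - F n) < e"
  obtains L where "l2_fps L" "(\<lambda>k. l2_sq (F k - L)) \<longlonglongrightarrow> 0" "\<And>i. (\<lambda>k. F k $ i) \<longlonglongrightarrow> L $ i"
proof -
  have "convergent (\<lambda>k. F k $ i)" for i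
  proof (rule Cauchy_convergent, rule metric_CauchyI)
    fix e :: real
    assume e: "e > 0"
    then obtain N where N: "\<forall>m\<ge>N. \<forall>n\<ge>N. l2_sq (F m - F n) < e\<^sup>2"
      using Cauchy by (meson zero_less_power)
    have "dist (F m $ i) (F n $ i) < e" if "m \<ge> N" "n \<ge> N" for m n
    proof (rule power2_less_imp_less)
      show "(dist (F m $ i) (F n $ i))\<^sup>2 < e\<^sup>2"
        using nth_le_l2_sq[OF l2_fps_diff[OF l2 l2], of m n i] N that
        by (force simp: dist_norm)
    qed (use e in simp)
    then show "\<exists>M. \<forall>m\<ge>M. \<forall>n\<ge>M. dist (F m $ i) (F n $ i) < e"
      by blast
  qed
  then obtain l where l: "\<And>i. (\<lambda>k. F k $ i) \<longlonglongrightarrow> l i"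
    unfolding convergent_def by metis
  define L where "L = Abs_fps l"
  have bound: "l2_fps (F m - L) \<and> l2_sq (F m - L) \<le> e"
    if N: "\<forall>m\<ge>N. \<forall>n\<ge>N. l2_sq (F m - F n) < e" and m: "m \<ge> N" for e N m
  proof -
    have partial: "(\<Sum>i<M. (cmod ((F m - L) $ i))\<^sup>2) \<le> e" for M
    proof (rule tendsto_upperbound)
      show "(\<lambda>n. \<Sum>i<M. (cmod ((F m - F n) $ i))\<^sup>2) \<longlonglongrightarrow> (\<Sum>i<M. (cmod ((F m - L) $ i))\<^sup>2)"
        by (auto intro!: tendsto_intros l simp: L_def)
      have "(\<Sum>i<M. (cmod ((F m - F n) $ i))\<^sup>2) \<le> e" if "n \<ge> N" for n
      proof -
        have "(\<Sum>i<M. (cmod ((F m - F n) $ i))\<^sup>2) \<le> l2_sq (F m - F n)"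
          unfolding l2_sq_def using l2_fps_diff[OF l2 l2, of m n]
          by (intro sum_le_suminf) (auto simp: l2_fps_def)
        then show ?thesis
          using N m that by force
      qed
      then show "\<forall>\<^sub>F n in sequentially. (\<Sum>i<M. (cmod ((F m - F n) $ i))\<^sup>2) \<le> e"
        by (auto simp: eventually_sequentially)
    qed simp
    have "l2_fps (F m - L)"
      unfolding l2_fps_def using partial by (intro summableI_nonneg_bounded) auto
    moreover have "l2_sq (F m - L) \<le> e"
      unfolding l2_sq_def
      using suminf_le_const[OF _ partial] \<open>l2_fps (F m - L)\<close> by (simp add: l2_fps_def)
    ultimately show ?thesis ..
  qed
  have L: "l2_fps L"
  proof -
    obtain N where "\<forall>m\<ge>N. \<forall>n\<ge>N. l2_sq (F m - F n) < 1"
      using Cauchy zero_less_one by blast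
    then have "l2_fps (F N - L)"
      using bound by blast
    from l2_fps_diff[OF l2[of N] this] show ?thesis
      by simp
  qed
  have "(\<lambda>k. l2_sq (F k - L)) \<longlonglongrightarrow> 0"
  proof (rule LIMSEQ_I)
    fix r :: real
    assume "r > 0"
    then obtain N where "\<forall>m\<ge>N. \<forall>n\<ge>N. l2_sq (F m - F n) < r / 2"
      using Cauchy half_gt_zero by blast
    from bound[OF this] show "\<exists>no. \<forall>n\<ge>no. norm (l2_sq (F n - L) - 0) < r"
      using \<open>r > 0\<close> l2_sq_nonneg[of "F _ - L"] by (intro exI[of _ N]) fastforce
  qed
  then show ?thesis
    using that[of L] L l by (simp add: L_def)
qed

section \<open>Convergence in the disk and beyond it\<close>

lemma bounded_coeffs_imp_conv_radius:
  assumes "\<And>n. cmod (F $ n) \<le> C"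
  shows "fps_conv_radius F \<ge> 1"
  unfolding fps_conv_radius_def
proof (rule conv_radius_geI_ex')
  fix r :: real
  assume r: "0 < r" "ereal r < 1"
  show "summable (\<lambda>n. F $ n * of_real r ^ n)"
  proof (rule summable_comparison_test')
    show "summable (\<lambda>n. C * r ^ n)"
      using r by (intro summable_mult summable_geometric) simp
    show "norm (F $ n * of_real r ^ n) \<le> C * r ^ n" for n
      using r assms[of n] by (simp add: norm_mult norm_power mult_right_mono)
  qed
qed

lemma l2_fps_conv_radius: "l2_fps F \<Longrightarrow> fps_conv_radius F \<ge> 1"
  using nth_le_l2_sq[of F] by (intro bounded_coeffs_imp_conv_radius[of F "sqrt (l2_sq F)"] real_le_rsqrt)

lemma l2_fps_less_conv_radius: "l2_fps F \<Longrightarrow> cmod z < 1 \<Longrightarrow> ereal (cmod z) < fps_conv_radius F"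
  using l2_fps_conv_radius[of F] less_le_trans[of "ereal (cmod z)" 1] by simp

lemma conv_radius_gt_1_summable:
  fixes F :: "complex fps"
  shows "fps_conv_radius F > 1 \<Longrightarrow> summable (\<lambda>n. cmod (F $ n))"
  using norm_summable_fps[of 1 F] by (simp flip: one_ereal_def)

lemma conv_radius_gt_1_l2:
  assumes "fps_conv_radius F > 1"
  shows "l2_fps F"
proof -
  note s = conv_radius_gt_1_summable[OF assms]
  have "\<forall>\<^sub>F n in sequentially. cmod (F $ n) < 1"
    using summable_LIMSEQ_zero[OF s] by (rule order_tendstoD) simp
  then have "\<forall>\<^sub>F n in sequentially. norm ((cmod (F $ n))\<^sup>2) \<le> cmod (F $ n)"
    by eventually_elim (simp add: power2_eq_square mult_left_le)
  then show ?thesis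
    unfolding l2_fps_def using s by (rule summable_comparison_test_ev)
qed

text \<open>Since there are only finitely many zeros, they keep a positive distance from the closed
  disk. This margin gives reciprocals a radius of convergence above 1 and so absolutely summable
  coefficients.\<close>

lemma poly_nonzero_beyond_disc:
  fixes r :: "complex poly"
  assumes "\<And>z. cmod z \<le> 1 \<Longrightarrow> poly r z \<noteq> 0"
  obtains R where "R > 1" "\<And>z. cmod z < R \<Longrightarrow> poly r z \<noteq> 0"
proof -
  have r0: "r \<noteq> 0"
    using assms[of 0] by auto
  \<comment> \<open>The element 2 keeps \<open>S\<close> nonempty when \<open>r\<close> has no
    zeros.\<close>
  define S where "S = insert 2 (cmod ` {z. poly r z = 0})"
  have fin: "finite S"
    using poly_roots_finite[OF r0] by (simp add: S_def)
  have gt: "Min S > 1"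
    using assms fin by (subst Min_gr_iff) (auto simp: S_def not_le[symmetric])
  have "poly r z \<noteq> 0" if "cmod z < Min S" for z
  proof
    assume "poly r z = 0"
    then have "cmod z \<in> S"
      by (auto simp: S_def)
    then show False
      using Min_le[OF fin] that by force
  qed
  with gt that show ?thesis
    by blast
qed

lemma inverse_poly_fps:
  fixes r :: "complex poly"
  assumes "\<And>z. cmod z < R \<Longrightarrow> poly r z \<noteq> 0"
  shows "fps_conv_radius (fps_of_poly p * inverse (fps_of_poly r)) \<ge> ereal R"
    and "cmod z < R \<Longrightarrow> eval_fps (fps_of_poly p * inverse (fps_of_poly r)) z = poly p z / poly r z"
proof -
  have nz: "eval_fps (fps_of_poly r) z \<noteq> 0" if "ereal (cmod z) < ereal R" for z
    using assms that by simp
  have rad: "fps_conv_radius (inverse (fps_of_poly r)) \<ge> ereal R"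
    using fps_conv_radius_inverse[of "ereal R", OF nz] by simp
  then show "fps_conv_radius (fps_of_poly p * inverse (fps_of_poly r)) \<ge> ereal R"
    using order_trans[OF _ fps_conv_radius_mult[of "fps_of_poly p" "inverse (fps_of_poly r)"]] by simp
  assume z: "cmod z < R"
  then have "ereal (cmod z) < fps_conv_radius (inverse (fps_of_poly r))"
    using rad by (meson less_ereal.simps(1) less_le_trans)
  then show "eval_fps (fps_of_poly p * inverse (fps_of_poly r)) z = poly p z / poly r z"
    using eval_fps_inverse[of "ereal R", OF nz, of z] z
    by (simp add: eval_fps_mult divide_inverse)
qed

lemma inverse_poly_fps_conv_radius:
  assumes "\<And>z. cmod z \<le> 1 \<Longrightarrow> poly r z \<noteq> 0"
  shows "fps_conv_radius (fps_of_poly p * inverse (fps_of_poly r)) > 1"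
proof -
  obtain R where R: "R > 1" "\<And>z. cmod z < R \<Longrightarrow> poly r z \<noteq> 0"
    using poly_nonzero_beyond_disc assms by blast
  then show ?thesis
    using inverse_poly_fps(1)[of R r p] by (metis less_ereal.simps(1) less_le_trans one_ereal_def)
qed

section \<open>Toeplitz operators with conjugate polynomial symbols\<close>

text \<open>
  The adjoint, on square summable sequences, of multiplication by the polynomial \<open>p\<close>: the
  Toeplitz operator with symbol the conjugate of \<open>p\<close>.
\<close>

definition adj_mult :: "complex poly \<Rightarrow> complex fps \<Rightarrow> complex fps" where
  "adj_mult p u = Abs_fps (\<lambda>m. \<Sum>i\<le>degree p. cnj (coeff p i) * u $ (m + i))"

lemma adj_mult_nth:
  assumes "degree p \<le> d"
  shows "adj_mult p u $ m = (\<Sum>i\<le>d. cnj (coeff p i) * u $ (m + i))"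
  unfolding adj_mult_def fps_nth_Abs_fps
  by (rule sum.mono_neutral_left) (use assms in \<open>auto simp: coeff_eq_0\<close>)

lemma adj_mult_0 [simp]: "adj_mult 0 u = 0"
  by (simp add: fps_eq_iff adj_mult_def)

lemma adj_mult_add_poly: "adj_mult (p + q) u = adj_mult p u + adj_mult q u"
proof (rule fps_ext)
  fix m
  define d where "d = max (degree p) (degree q)"
  have "degree p \<le> d" "degree q \<le> d" "degree (p + q) \<le> d"
    by (auto simp: d_def degree_add_le_max)
  then show "adj_mult (p + q) u $ m = (adj_mult p u + adj_mult q u) $ m"
    by (simp add: adj_mult_nth sum.distrib algebra_simps)
qed

lemma adj_mult_smult_poly: "adj_mult (smult c p) u = fps_const (cnj c) * adj_mult p u"
  by (rule fps_ext) (simp add: adj_mult_nth[of _ "degree p"] sum_distrib_left mult_ac)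

lemma adj_mult_pCons: "adj_mult (pCons a p) u = fps_const (cnj a) * u + adj_mult p (fps_shift 1 u)"
proof (rule fps_ext)
  fix m
  have "adj_mult (pCons a p) u $ m = (\<Sum>i\<le>Suc (degree p). cnj (coeff (pCons a p) i) * u $ (m + i))"
    by (rule adj_mult_nth) (rule degree_pCons_le)
  also have "\<dots> = cnj a * u $ m + adj_mult p (fps_shift 1 u) $ m"
    by (subst sum.atMost_Suc_shift) (simp add: adj_mult_nth[of p "degree p"])
  finally show "adj_mult (pCons a p) u $ m = (fps_const (cnj a) * u + adj_mult p (fps_shift 1 u)) $ m"
    by simp
qed

lemma adj_mult_linear:
  "adj_mult p (u + v) = adj_mult p u + adj_mult p v"
  "adj_mult p (u - v) = adj_mult p u - adj_mult p v"
  "adj_mult p (fps_const c * u) = fps_const c * adj_mult p u"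
  "adj_mult p (fps_shift k u) = fps_shift k (adj_mult p u)"
  "adj_mult p 0 = 0"
  by (simp_all add: fps_eq_iff adj_mult_def sum.distrib sum_subtractf sum_distrib_left algebra_simps)

text \<open>All these operators are polynomials in the backward shift. In particular they commute,
  so \<open>adj_mult A\<close> and \<open>adj_mult B\<close> can be interchanged.\<close>

lemma adj_mult_mult: "adj_mult (p * q) u = adj_mult p (adj_mult q u)"
proof (induction p)
  case (pCons a p)
  show ?case
    by (simp add: mult_pCons_left adj_mult_add_poly adj_mult_smult_poly adj_mult_pCons
        adj_mult_linear(4) pCons.IH[symmetric] del: One_nat_def)
qed simp

lemma l2_fps_adj_mult: "l2_fps u \<Longrightarrow> l2_fps (adj_mult p u)"
proof (induction p arbitrary: u)
  case (pCons a p)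
  then show ?case
    by (simp add: adj_mult_pCons l2_fps_add l2_fps_const_mult l2_fps_shift)
qed simp

lemma l2_ip_poly_mult:
  assumes "l2_fps F" "l2_fps G"
  shows "l2_ip F (fps_of_poly p * G) = l2_ip (adj_mult p F) G"
  using assms(1)
proof (induction p arbitrary: F)
  case (pCons a p)
  have eq: "fps_of_poly (pCons a p) * G = fps_const a * G + fps_X * (fps_of_poly p * G)"
    by (simp add: fps_of_poly_pCons algebra_simps)
  show ?case
    unfolding eq adj_mult_pCons using pCons assms(2)
    by (simp add: l2_ip_add_right l2_ip_add_left l2_ip_const_left l2_ip_const_right l2_ip_X_mult
        l2_fps_const_mult l2_fps_X_mult l2_fps_poly_mult l2_fps_shift l2_fps_adj_mult del: One_nat_def)
qed (simp add: l2_ip_def)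

text \<open>
  The reflection \<open>z\<^sup>d * cnj (p (1 / cnj z))\<close>, which turns conjugation on the unit circle into a
  polynomial operation.
\<close>

definition conj_reflect :: "nat \<Rightarrow> complex poly \<Rightarrow> complex poly" where
  "conj_reflect d p = (\<Sum>i\<le>d. monom (cnj (coeff p (d - i))) i)"

lemma coeff_conj_reflect: "coeff (conj_reflect d p) i = (if i \<le> d then cnj (coeff p (d - i)) else 0)"
  by (simp add: conj_reflect_def coeff_sum)

lemma poly_conj_reflect:
  assumes "degree p \<le> d" "cmod z = 1"
  shows "poly (conj_reflect d p) z = z ^ d * cnj (poly p z)"
proof -
  have z: "z * cnj z = 1"
    using complex_norm_square[of z] assms by simp
  have "poly (conj_reflect d p) z = (\<Sum>i\<le>d. cnj (coeff p (d - i)) * z ^ i)"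
    by (simp add: conj_reflect_def poly_sum poly_monom)
  also have "\<dots> = (\<Sum>i\<le>d. cnj (coeff p i) * z ^ (d - i))"
    by (rule sum.reindex_bij_witness[of _ "\<lambda>i. d - i" "\<lambda>i. d - i"]) auto
  also have "\<dots> = (\<Sum>i\<le>d. z ^ d * cnj (coeff p i * z ^ i))"
  proof (rule sum.cong)
    fix i
    assume "i \<in> {..d}"
    then have "z ^ d = z ^ (d - i) * z ^ i"
      by (simp flip: power_add)
    moreover have "z ^ i * cnj z ^ i = 1"
      using z by (simp flip: power_mult_distrib)
    ultimately show "cnj (coeff p i) * z ^ (d - i) = z ^ d * cnj (coeff p i * z ^ i)"
      by (simp add: mult.assoc mult.left_commute[of _ "cnj (coeff p i)"])
  qed simp
  also have "\<dots> = z ^ d * cnj (\<Sum>i\<le>d. coeff p i * z ^ i)"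
    by (simp add: sum_distrib_left)
  also have "(\<Sum>i\<le>d. coeff p i * z ^ i) = poly p z"
    unfolding poly_altdef
    by (rule sum.mono_neutral_right) (use assms in \<open>auto simp: coeff_eq_0\<close>)
  finally show ?thesis .
qed

text \<open>On the circle the conjugate of \<open>p\<close> is the reflected polynomial divided by
  \<open>z^d\<close>; dropping the first \<open>d\<close> coefficients is the projection onto
  nonnegative frequencies. The freedom in \<open>d\<close> lets several polynomials share one
  shift.\<close>

lemma adj_mult_conv_conj_reflect:
  assumes "degree p \<le> d"
  shows "adj_mult p u = fps_shift d (fps_of_poly (conj_reflect d p) * u)"
proof (rule fps_ext)
  fix m
  have "fps_shift d (fps_of_poly (conj_reflect d p) * u) $ m
      = (\<Sum>i=0..m + d. coeff (conj_reflect d p) i * u $ (m + d - i))"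
    by (simp add: fps_mult_nth)
  also have "\<dots> = (\<Sum>i\<le>d. cnj (coeff p (d - i)) * u $ (m + d - i))"
    by (rule sum.mono_neutral_cong_right) (auto simp: coeff_conj_reflect)
  also have "\<dots> = (\<Sum>i\<le>d. cnj (coeff p i) * u $ (m + i))"
    by (rule sum.reindex_bij_witness[of _ "\<lambda>i. d - i" "\<lambda>i. d - i"]) auto
  finally show "adj_mult p u $ m = fps_shift d (fps_of_poly (conj_reflect d p) * u) $ m"
    using assms by (simp add: adj_mult_nth)
qed

lemma poly_eq_on_circle:
  fixes p q :: "complex poly"
  assumes "\<And>z. cmod z = 1 \<Longrightarrow> poly p z = poly q z"
  shows "p = q"
proof (rule ccontr)
  assume "p \<noteq> q"
  then have "finite {z. poly (p - q) z = 0}"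
    by (intro poly_roots_finite) simp
  then have "finite (sphere (0::complex) 1)"
    by (rule rev_finite_subset) (auto simp: assms)
  moreover have "connected (sphere (0::complex) 1)"
    by (rule connected_sphere) simp
  moreover have "1 \<in> sphere (0::complex) 1" "-1 \<in> sphere (0::complex) 1"
    by auto
  ultimately show False
    by (metis connected_finite_iff_sing empty_iff one_neq_neg_one singletonD)
qed

text \<open>After reflection with a common \<open>d\<close>, the identity on the circle is one
  between polynomials, and it may be multiplied by an arbitrary formal series
  \<open>h\<close>.\<close>

lemma adj_mult_isometry:
  assumes "\<And>z. cmod z = 1 \<Longrightarrow> (cmod (poly B z))\<^sup>2 + (cmod (poly A z))\<^sup>2 = (cmod (poly Q z))\<^sup>2"
  shows "adj_mult B (fps_of_poly B * h) + adj_mult A (fps_of_poly A * h) = adj_mult Q (fps_of_poly Q * h)"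
proof -
  define d where "d = max (degree B) (max (degree A) (degree Q))"
  have d: "degree B \<le> d" "degree A \<le> d" "degree Q \<le> d"
    by (auto simp: d_def)
  have "conj_reflect d B * B + conj_reflect d A * A = conj_reflect d Q * Q"
  proof (rule poly_eq_on_circle)
    fix z :: complex
    assume z: "cmod z = 1"
    have "poly (conj_reflect d p * p) z = z ^ d * of_real ((cmod (poly p z))\<^sup>2)" if "degree p \<le> d" for p
      using poly_conj_reflect[OF that z] complex_norm_square[of "poly p z"] by simp
    then show "poly (conj_reflect d B * B + conj_reflect d A * A) z = poly (conj_reflect d Q * Q) z"
      using assms[OF z] d by (simp only: poly_add flip: distrib_left of_real_add)
  qed
  then have "fps_of_poly (conj_reflect d B) * fps_of_poly B + fps_of_poly (conj_reflect d A) * fps_of_poly A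
      = fps_of_poly (conj_reflect d Q) * fps_of_poly Q"
    by (simp flip: fps_of_poly_mult fps_of_poly_add)
  then have "(fps_of_poly (conj_reflect d B) * fps_of_poly B + fps_of_poly (conj_reflect d A) * fps_of_poly A) * h
      = fps_of_poly (conj_reflect d Q) * fps_of_poly Q * h"
    by simp
  then show ?thesis
    using d by (simp add: adj_mult_conv_conj_reflect algebra_simps flip: fps_shift_add)
qed

text \<open>Split off a root \<zeta>, for which \<open>cmod \<zeta> \<ge> 1\<close>. A sequence with
  \<open>v $ Suc n = cnj \<zeta> * v $ n\<close> has nondecreasing moduli, yet square summability
  makes it tend to 0. Roots on the circle are therefore harmless.\<close>

lemma adj_mult_inj:
  assumes "\<And>z. cmod z < 1 \<Longrightarrow> poly p z \<noteq> 0" "l2_fps u" "adj_mult p u = 0"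
  shows "u = 0"
  using assms
proof (induction "degree p" arbitrary: p u rule: less_induct)
  case less
  have p0: "p \<noteq> 0"
    using less.prems(1)[of 0] by auto
  show ?case
  proof (cases "degree p = 0")
    case True
    then obtain c where c: "p = [:c:]"
      by (auto elim: degree_eq_zeroE)
    then show ?thesis
      using p0 less.prems(3) by (simp add: adj_mult_pCons fps_eq_iff)
  next
    case False
    then obtain \<zeta> where \<zeta>: "poly p \<zeta> = 0"
      using Fundamental_Theorem_Algebra.fundamental_theorem_of_algebra[of p] by (auto simp: constant_degree)
    then obtain r where r: "p = [:-\<zeta>, 1:] * r"
      by (auto simp: poly_eq_0_iff_dvd)
    define v where "v = adj_mult r u"
    have v: "l2_fps v"
      using less.prems by (simp add: v_def l2_fps_adj_mult)
    have "adj_mult [:-\<zeta>, 1:] v = 0"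
      using less.prems(3) unfolding r adj_mult_mult v_def .
    then have rec: "v $ Suc n = cnj \<zeta> * v $ n" for n
      by (auto simp: adj_mult_pCons fps_eq_iff dest: spec[of _ n])
    have "cmod \<zeta> \<ge> 1"
      using less.prems(1) \<zeta> by force
    then have mono: "cmod (v $ n) \<le> cmod (v $ Suc n)" for n
      using mult_right_mono[of 1 "cmod \<zeta>" "cmod (v $ n)"] by (simp add: rec norm_mult)
    have "(\<lambda>n. cmod (v $ n)) \<longlonglongrightarrow> 0"
      using l2_fps_tendsto_0[OF v] by (rule tendsto_norm_zero)
    moreover have "incseq (\<lambda>n. cmod (v $ n))"
      using mono by (rule incseq_SucI)
    ultimately have "cmod (v $ n) \<le> 0" for n
      by (rule incseq_le[rotated])
    then have "v = 0"
      by (simp add: fps_eq_iff)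
    moreover have "degree r < degree p"
      using p0 unfolding r by (subst degree_mult_eq) auto
    moreover have "poly r z \<noteq> 0" if "cmod z < 1" for z
      using less.prems(1)[OF that] by (auto simp: r)
    ultimately show ?thesis
      using less.hyps less.prems(2) by (simp add: v_def)
  qed
qed

section \<open>The de Branges--Rovnyak space of a rational pair\<close>

lemma fps_of_poly_mult_geometric:
  "fps_of_poly [:1, - c:] * Abs_fps (\<lambda>n. c ^ n) = (1 :: complex fps)"
proof (rule fps_ext)
  fix n
  show "(fps_of_poly [:1, - c:] * Abs_fps (\<lambda>n. c ^ n)) $ n = (1 :: complex fps) $ n"
    by (cases n) (simp_all add: fps_of_poly_pCons algebra_simps)
qed

text \<open>The geometric series with ratio \<open>c\<close> is an eigenvector of the backward shift
  with eigenvalue \<open>c\<close>, hence of every polynomial in it.\<close>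

lemma adj_mult_geometric:
  "adj_mult p (Abs_fps (\<lambda>n. c ^ n)) = fps_const (cnj (poly p (cnj c))) * Abs_fps (\<lambda>n. c ^ n)"
  by (simp add: fps_eq_iff adj_mult_def poly_altdef power_add sum_distrib_left mult_ac)

text \<open>This is the reproducing property of the Szego kernel of \<open>H^2\<close>.\<close>

lemma l2_ip_geometric: "l2_ip F (Abs_fps (\<lambda>n. cnj w ^ n)) = eval_fps F w"
  by (simp add: l2_ip_def eval_fps_def)

locale pythagorean_polys =
  fixes A B Q :: "complex poly"
  assumes A_nonzero: "cmod z < 1 \<Longrightarrow> poly A z \<noteq> 0"
    and Q_nonzero: "cmod z \<le> 1 \<Longrightarrow> poly Q z \<noteq> 0"
    and circle: "cmod z = 1 \<Longrightarrow> (cmod (poly B z))\<^sup>2 + (cmod (poly A z))\<^sup>2 = (cmod (poly Q z))\<^sup>2"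
begin

text \<open>
  \<open>G\<close> is the Taylor series of the function usually denoted by \<open>f\<^sup>+\<close>; it is determined by \<open>f\<close>
  because \<open>adj_mult A\<close> is injective on square summable series.
\<close>

definition dbr_rep :: "(complex \<Rightarrow> complex) \<Rightarrow> complex fps \<Rightarrow> complex fps \<Rightarrow> bool" where
  "dbr_rep f F G \<longleftrightarrow> l2_fps F \<and> l2_fps G \<and> adj_mult B F = adj_mult A G \<and>
     (\<forall>z\<in>unit_disk. f z = eval_fps F z)"

definition dbr_model :: "(complex \<Rightarrow> complex) set" where
  "dbr_model = {f. \<exists>F G. dbr_rep f F G}"

definition companion :: "complex fps \<Rightarrow> complex fps" where
  "companion F = (THE G. l2_fps G \<and> adj_mult B F = adj_mult A G)"

text \<open>Passing through the Taylor series at 0 makes the inner product an operation on functions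
  that ignores their values off the disk.\<close>

definition dbr_ip :: "(complex \<Rightarrow> complex) \<Rightarrow> (complex \<Rightarrow> complex) \<Rightarrow> complex" where
  "dbr_ip f g = l2_ip (fps_expansion f 0) (fps_expansion g 0) +
     l2_ip (companion (fps_expansion f 0)) (companion (fps_expansion g 0))"

lemma dbr_rep_fps_expansion:
  assumes "dbr_rep f F G"
  shows "f has_fps_expansion F" "fps_expansion f 0 = F"
proof -
  have F: "l2_fps F" "\<And>z. z \<in> unit_disk \<Longrightarrow> f z = eval_fps F z"
    using assms by (auto simp: dbr_rep_def)
  have "fps_conv_radius F > 0"
    using l2_fps_less_conv_radius[OF F(1), of 0] by (simp flip: zero_ereal_def)
  moreover have "\<forall>\<^sub>F z in nhds 0. z \<in> (unit_disk :: complex set)"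
    by (intro eventually_nhds_in_open) auto
  then have "\<forall>\<^sub>F z in nhds 0. eval_fps F z = f z"
    by eventually_elim (use F(2) in auto)
  ultimately show "f has_fps_expansion F"
    by (simp add: has_fps_expansion_def)
  then show "fps_expansion f 0 = F"
    by (rule fps_expansion_eqI)
qed

lemma companion_eq:
  assumes "l2_fps G" "adj_mult B F = adj_mult A G"
  shows "companion F = G"
  unfolding companion_def
proof (rule the_equality)
  fix G'
  assume G': "l2_fps G' \<and> adj_mult B F = adj_mult A G'"
  have "G' - G = 0"
  proof (rule adj_mult_inj[OF A_nonzero])
    show "l2_fps (G' - G)"
      using G' assms(1) by (simp add: l2_fps_diff)
    show "adj_mult A (G' - G) = 0"
      using G' assms(2) by (simp add: adj_mult_linear(2))
  qed
  then show "G' = G"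
    by simp
qed (use assms in simp)

lemma dbr_rep_companion: "dbr_rep f F G \<Longrightarrow> companion F = G"
  unfolding dbr_rep_def by (blast intro: companion_eq)

lemma dbr_ip_eq: "dbr_rep f F G \<Longrightarrow> dbr_rep f' F' G' \<Longrightarrow> dbr_ip f f' = l2_ip F F' + l2_ip G G'"
  unfolding dbr_ip_def by (simp add: dbr_rep_fps_expansion dbr_rep_companion)

lemma dbr_norm_sq: "dbr_rep f F G \<Longrightarrow> Re (dbr_ip f f) = l2_sq F + l2_sq G"
  unfolding dbr_ip_eq by (simp add: l2_ip_self dbr_rep_def)

lemma dbr_rep_cong: "dbr_rep f F G \<Longrightarrow> (\<And>x. x \<in> unit_disk \<Longrightarrow> g x = f x) \<Longrightarrow> dbr_rep g F G"
  by (simp add: dbr_rep_def)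

lemma dbr_rep_add:
  "dbr_rep f F G \<Longrightarrow> dbr_rep f' F' G' \<Longrightarrow> dbr_rep (\<lambda>x. f x + f' x) (F + F') (G + G')"
  by (auto simp: dbr_rep_def l2_fps_add adj_mult_linear eval_fps_add l2_fps_less_conv_radius)

lemma dbr_rep_scale:
  "dbr_rep f F G \<Longrightarrow> dbr_rep (\<lambda>x. c * f x) (fps_const c * F) (fps_const c * G)"
  by (auto simp: dbr_rep_def l2_fps_const_mult adj_mult_linear eval_fps_mult l2_fps_less_conv_radius)

lemma dbr_rep_diff:
  "dbr_rep f F G \<Longrightarrow> dbr_rep f' F' G' \<Longrightarrow> dbr_rep (\<lambda>x. f x - f' x) (F - F') (G - G')"
  by (auto simp: dbr_rep_def l2_fps_diff adj_mult_linear eval_fps_diff l2_fps_less_conv_radius)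

lemma dbr_rep_0: "dbr_rep (\<lambda>x. 0) 0 0"
  by (simp add: dbr_rep_def adj_mult_linear)

text \<open>The relation between \<open>F\<close> and \<open>G\<close> is closed: each coefficient
  of \<open>adj_mult\<close> involves only finitely many coefficients of its argument, so
  coefficientwise limits preserve it.\<close>

lemma dbr_rep_limit:
  fixes f :: "nat \<Rightarrow> complex \<Rightarrow> complex"
  assumes rep: "\<And>n. dbr_rep (f n) (F n) (G n)"
    and Cauchy: "\<forall>e>0. \<exists>N. \<forall>m\<ge>N. \<forall>n\<ge>N. l2_sq (F m - F n) + l2_sq (G m - G n) < e"
  obtains g F' G' where "dbr_rep g F' G'"
    "(\<lambda>n. l2_sq (F n - F')) \<longlonglongrightarrow> 0" "(\<lambda>n. l2_sq (G n - G')) \<longlonglongrightarrow> 0"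
proof -
  have l2: "l2_fps (F n)" "l2_fps (G n)" and eq: "adj_mult B (F n) = adj_mult A (G n)" for n
    using rep[of n] by (auto simp: dbr_rep_def)
  have nonneg: "0 \<le> l2_sq (F m - F n)" "0 \<le> l2_sq (G m - G n)" for m n
    using l2 by (auto intro!: l2_sq_nonneg l2_fps_diff)
  have "\<forall>e>0. \<exists>N. \<forall>m\<ge>N. \<forall>n\<ge>N. l2_sq (F m - F n) < e"
    using Cauchy nonneg by (meson add_less_same_cancel1 le_less_trans less_add_same_cancel1
        add_increasing2 order_refl)
  then obtain F' where F': "l2_fps F'" "(\<lambda>n. l2_sq (F n - F')) \<longlonglongrightarrow> 0"
    "\<And>i. (\<lambda>n. F n $ i) \<longlonglongrightarrow> F' $ i"
    using l2_fps_Cauchy_limit[of F] l2 by blast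
  have "\<forall>e>0. \<exists>N. \<forall>m\<ge>N. \<forall>n\<ge>N. l2_sq (G m - G n) < e"
    using Cauchy nonneg by (meson add_less_same_cancel1 le_less_trans less_add_same_cancel1
        add_increasing order_refl)
  then obtain G' where G': "l2_fps G'" "(\<lambda>n. l2_sq (G n - G')) \<longlonglongrightarrow> 0"
    "\<And>i. (\<lambda>n. G n $ i) \<longlonglongrightarrow> G' $ i"
    using l2_fps_Cauchy_limit[of G] l2 by blast
  have "adj_mult B F' = adj_mult A G'"
  proof (rule fps_ext)
    fix i
    have "(\<lambda>n. adj_mult B (F n) $ i) \<longlonglongrightarrow> adj_mult B F' $ i"
      unfolding adj_mult_def fps_nth_Abs_fps by (intro tendsto_intros F')
    moreover have "(\<lambda>n. adj_mult A (G n) $ i) \<longlonglongrightarrow> adj_mult A G' $ i"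
      unfolding adj_mult_def fps_nth_Abs_fps by (intro tendsto_intros G')
    ultimately show "adj_mult B F' $ i = adj_mult A G' $ i"
      unfolding eq by (rule LIMSEQ_unique)
  qed
  then have "dbr_rep (eval_fps F') F' G'"
    using F' G' by (simp add: dbr_rep_def)
  then show ?thesis
    using that F'(2) G'(2) by blast
qed

lemma hilbert_function_space_dbr_model: "hilbert_function_space unit_disk dbr_model dbr_ip"
proof
  fix f g
  assume "f \<in> dbr_model" "\<And>x. x \<in> unit_disk \<Longrightarrow> g x = f x"
  then show "g \<in> dbr_model"
    unfolding dbr_model_def using dbr_rep_cong by blast
next
  show "(\<lambda>x. 0) \<in> dbr_model"
    unfolding dbr_model_def using dbr_rep_0 by blast
next
  fix f g
  assume "f \<in> dbr_model" "g \<in> dbr_model"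
  then show "(\<lambda>x. f x + g x) \<in> dbr_model"
    unfolding dbr_model_def using dbr_rep_add by blast
next
  fix f c
  assume "f \<in> dbr_model"
  then show "(\<lambda>x. c * f x) \<in> dbr_model"
    unfolding dbr_model_def using dbr_rep_scale by blast
next
  fix f g h
  assume "f \<in> dbr_model" "g \<in> dbr_model" "h \<in> dbr_model"
  then obtain F F' G G' K K' where rep: "dbr_rep f F F'" "dbr_rep g G G'" "dbr_rep h K K'"
    by (auto simp: dbr_model_def)
  then show "dbr_ip (\<lambda>x. f x + g x) h = dbr_ip f h + dbr_ip g h"
    by (simp add: dbr_ip_eq[OF dbr_rep_add[OF rep(1,2)] rep(3)] dbr_ip_eq[OF rep(1,3)]
        dbr_ip_eq[OF rep(2,3)] l2_ip_add_left dbr_rep_def)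
next
  fix f h c
  assume "f \<in> dbr_model" "h \<in> dbr_model"
  then obtain F F' K K' where rep: "dbr_rep f F F'" "dbr_rep h K K'"
    by (auto simp: dbr_model_def)
  then show "dbr_ip (\<lambda>x. c * f x) h = c * dbr_ip f h"
    by (simp add: dbr_ip_eq[OF dbr_rep_scale[OF rep(1)] rep(2)] dbr_ip_eq[OF rep]
        l2_ip_const_left dbr_rep_def distrib_left)
next
  fix f g
  assume "f \<in> dbr_model" "g \<in> dbr_model"
  then obtain F F' G G' where rep: "dbr_rep f F F'" "dbr_rep g G G'"
    by (auto simp: dbr_model_def)
  then show "dbr_ip g f = cnj (dbr_ip f g)"
    using l2_ip_cnj[of F G] l2_ip_cnj[of F' G']
    by (simp add: dbr_ip_eq[OF rep] dbr_ip_eq[OF rep(2,1)] dbr_rep_def)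
next
  fix f
  assume "f \<in> dbr_model"
  then obtain F G where rep: "dbr_rep f F G"
    by (auto simp: dbr_model_def)
  then have l2: "l2_fps F" "l2_fps G" and f: "\<And>z. z \<in> unit_disk \<Longrightarrow> f z = eval_fps F z"
    by (auto simp: dbr_rep_def)
  show "0 \<le> Re (dbr_ip f f)"
    using l2 by (simp add: dbr_norm_sq[OF rep] l2_sq_nonneg)
  show "dbr_ip f f = 0 \<longleftrightarrow> (\<forall>x\<in>unit_disk. f x = 0)"
  proof
    assume "dbr_ip f f = 0"
    then have "l2_sq F + l2_sq G = 0"
      using dbr_norm_sq[OF rep] by simp
    then have "F = 0"
      using l2_sq_nonneg[OF l2(1)] l2_sq_nonneg[OF l2(2)] l2_sq_eq_0_iff[OF l2(1)] by simp
    then show "\<forall>x\<in>unit_disk. f x = 0"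
      using f by simp
  next
    assume "\<forall>x\<in>unit_disk. f x = 0"
    then have "dbr_rep f 0 0"
      using dbr_rep_cong[OF dbr_rep_0] by simp
    then show "dbr_ip f f = 0"
      by (simp add: dbr_ip_eq l2_ip_def)
  qed
next
  fix f :: "nat \<Rightarrow> complex \<Rightarrow> complex"
  assume "\<And>n. f n \<in> dbr_model"
  then obtain F G where rep: "\<And>n. dbr_rep (f n) (F n) (G n)"
    unfolding dbr_model_def mem_Collect_eq by metis
  have norm_eq: "ip_norm dbr_ip (\<lambda>x. f m x - g x) = sqrt (l2_sq (F m - F') + l2_sq (G m - G'))"
    if "dbr_rep g F' G'" for m g F' G'
    unfolding ip_norm_def dbr_norm_sq[OF dbr_rep_diff[OF rep that]] ..
  assume Cauchy: "\<forall>e>0. \<exists>N. \<forall>m\<ge>N. \<forall>n\<ge>N. ip_norm dbr_ip (\<lambda>x. f m x - f n x) < e"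
  have "\<forall>e>0. \<exists>N. \<forall>m\<ge>N. \<forall>n\<ge>N. l2_sq (F m - F n) + l2_sq (G m - G n) < e"
  proof safe
    fix e :: real
    assume "e > 0"
    then show "\<exists>N. \<forall>m\<ge>N. \<forall>n\<ge>N. l2_sq (F m - F n) + l2_sq (G m - G n) < e"
      using Cauchy[rule_format, of "sqrt e"] by (simp add: norm_eq[OF rep])
  qed
  then obtain g F' G' where g: "dbr_rep g F' G'"
    "(\<lambda>n. l2_sq (F n - F')) \<longlonglongrightarrow> 0" "(\<lambda>n. l2_sq (G n - G')) \<longlonglongrightarrow> 0"
    using dbr_rep_limit[of f F G] rep by blast
  have "(\<lambda>n. ip_norm dbr_ip (\<lambda>x. f n x - g x)) \<longlonglongrightarrow> 0"
    unfolding norm_eq[OF g(1)]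
    using tendsto_real_sqrt[OF tendsto_add[OF g(2,3)]] by simp
  then show "\<exists>g\<in>dbr_model. (\<lambda>n. ip_norm dbr_ip (\<lambda>x. f n x - g x)) \<longlonglongrightarrow> 0"
    using g(1) unfolding dbr_model_def by blast
qed

text \<open>With \<open>h w\<close> the series of \<open>1 / (Q * (1 - cnj w * z))\<close>,
  \<open>Q * h w\<close> is the Szego kernel \<open>k w\<close>. The kernel of \<open>b\<close> at
  \<open>w\<close> has series \<open>F w = k w - cnj (b w) * B * h w\<close> and partner
  \<open>G w = cnj (b w) * A * h w\<close>; that they are related follows from
  \<open>adj_mult_isometry\<close> and the eigenvector property of \<open>k w\<close>.\<close>

lemma rkhs_dbr_model:
  assumes b: "\<And>z. cmod z < 1 \<Longrightarrow> b z = poly B z / poly Q z"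
  shows "rkhs unit_disk (dbr_kernel b) dbr_model dbr_ip"
proof -
  define h where "h w = inverse (fps_of_poly (Q * [:1, - cnj w:]))" for w
  define F where "F w = fps_of_poly (Q - smult (cnj (b w)) B) * h w" for w
  define G where "G w = fps_of_poly (smult (cnj (b w)) A) * h w" for w
  define k where "k w = Abs_fps (\<lambda>n. cnj w ^ n)" for w
  have h_l2: "l2_fps (h w)" and Qh: "fps_of_poly Q * h w = k w"
    and rep: "dbr_rep (\<lambda>z. dbr_kernel b z w) (F w) (G w)" if w: "cmod w < 1" for w
  proof -
    have nz: "poly (Q * [:1, - cnj w:]) z \<noteq> 0" if "cmod z \<le> 1" for z
    proof -
      have "cmod (z * cnj w) < 1"
        using mult_mono[OF that order_refl, of "cmod w"] w by (simp add: norm_mult)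
      then show ?thesis
        using Q_nonzero[OF that] by auto
    qed
    have l2: "l2_fps (fps_of_poly p * h w)" for p
      unfolding h_def by (intro conv_radius_gt_1_l2 inverse_poly_fps_conv_radius nz)
    from l2[of 1] show h_l2: "l2_fps (h w)"
      by simp
    have "fps_of_poly (Q * [:1, - cnj w:]) * h w = 1"
      unfolding h_def using nz[of 0] by (intro inverse_mult_eq_1') (simp add: poly_0_coeff_0)
    then have *: "fps_of_poly [:1, - cnj w:] * (fps_of_poly Q * h w) = 1"
      unfolding fps_of_poly_mult by (simp only: mult_ac)
    \<comment> \<open>The inserted factor is 1. Regrouping cancels the linear factor against
      \<open>h w\<close> and leaves \<open>k w\<close>.\<close>
    have "fps_of_poly Q * h w = (fps_of_poly [:1, - cnj w:] * k w) * (fps_of_poly Q * h w)"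
      unfolding k_def fps_of_poly_mult_geometric by simp
    also have "\<dots> = k w * (fps_of_poly [:1, - cnj w:] * (fps_of_poly Q * h w))"
      by (simp only: mult_ac)
    finally show Qh: "fps_of_poly Q * h w = k w"
      unfolding * by simp
    have bQ: "b w * poly Q w = poly B w"
      using b[OF w] Q_nonzero[of w] w by simp
    have F: "F w = k w - fps_const (cnj (b w)) * (fps_of_poly B * h w)"
      unfolding F_def Qh[symmetric] by (simp add: fps_of_poly_diff fps_of_poly_smult algebra_simps)
    have G: "G w = fps_const (cnj (b w)) * (fps_of_poly A * h w)"
      unfolding G_def by (simp add: fps_of_poly_smult algebra_simps)
    have "adj_mult B (fps_of_poly B * h w) + adj_mult A (fps_of_poly A * h w)
        = fps_const (cnj (poly Q w)) * k w"
      using adj_mult_isometry[of B A Q "h w"] circle unfolding Qh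
      by (simp add: k_def adj_mult_geometric)
    then have "adj_mult A (fps_of_poly A * h w)
        = fps_const (cnj (poly Q w)) * k w - adj_mult B (fps_of_poly B * h w)"
      by (simp add: algebra_simps)
    moreover have "adj_mult B (k w) = fps_const (cnj (b w)) * (fps_const (cnj (poly Q w)) * k w)"
      by (simp add: k_def adj_mult_geometric mult.assoc[symmetric] flip: bQ)
    ultimately have "adj_mult B (F w) = adj_mult A (G w)"
      unfolding F G by (simp only: adj_mult_linear right_diff_distrib)
    moreover have "dbr_kernel b z w = eval_fps (F w) z" if z: "z \<in> unit_disk" for z
    proof -
      have "eval_fps (F w) z = poly (Q - smult (cnj (b w)) B) z / poly (Q * [:1, - cnj w:]) z"
        unfolding F_def h_def by (rule inverse_poly_fps(2)[of 1]) (use nz z in auto)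
      also have "\<dots> = (poly Q z - cnj (b w) * (b z * poly Q z)) / (poly Q z * (1 - cnj w * z))"
        using b[of z] Q_nonzero[of z] z by (simp add: algebra_simps)
      also have "\<dots> = (poly Q z * (1 - cnj (b w) * b z)) / (poly Q z * (1 - cnj w * z))"
        by (simp add: algebra_simps)
      finally show ?thesis
        using Q_nonzero[of z] z by (simp add: dbr_kernel_def)
    qed
    ultimately show "dbr_rep (\<lambda>z. dbr_kernel b z w) (F w) (G w)"
      unfolding dbr_rep_def using l2 by (simp add: F_def G_def)
  qed
  interpret hilbert_function_space unit_disk dbr_model dbr_ip
    by (rule hilbert_function_space_dbr_model)
  show ?thesis
  proof
    fix w :: complex
    assume "w \<in> unit_disk"
    then show "(\<lambda>z. dbr_kernel b z w) \<in> dbr_model"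
      unfolding dbr_model_def using rep[of w] by auto
  next
    fix f and w :: complex
    assume "f \<in> dbr_model" and w: "w \<in> unit_disk"
    then obtain F' G' where f: "dbr_rep f F' G'"
      by (auto simp: dbr_model_def)
    then have f': "l2_fps F'" "l2_fps G'" "adj_mult B F' = adj_mult A G'" "f w = eval_fps F' w"
      using w by (auto simp: dbr_rep_def)
    have w': "cmod w < 1"
      using w by simp
    have "fps_of_poly (smult c p) = fps_const c * fps_of_poly p" for c and p :: "complex poly"
      by (rule fps_of_poly_smult)
    then have F: "F w = fps_of_poly Q * h w - fps_const (cnj (b w)) * (fps_of_poly B * h w)"
      and G: "G w = fps_const (cnj (b w)) * (fps_of_poly A * h w)"
      by (simp_all add: F_def G_def fps_of_poly_diff algebra_simps)
    \<comment> \<open>By adjointness the two contributions of \<open>h w\<close> are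
      \<open>b w\<close> times the pairings of \<open>adj_mult B F'\<close> and
      \<open>adj_mult A G'\<close> with it, with opposite signs. They cancel and only the Szego
      kernel remains.\<close>
    have "dbr_ip f (\<lambda>z. dbr_kernel b z w) = l2_ip F' (F w) + l2_ip G' (G w)"
      using dbr_ip_eq[OF f rep[OF w']] .
    also have "l2_ip F' (F w) = l2_ip F' (k w) - b w * l2_ip (adj_mult B F') (h w)"
      unfolding F by (subst l2_ip_diff_right)
        (simp_all add: l2_ip_const_right l2_ip_poly_mult l2_fps_const_mult l2_fps_poly_mult
          h_l2 w' f' flip: Qh)
    also have "l2_ip G' (G w) = b w * l2_ip (adj_mult A G') (h w)"
      unfolding G
      by (simp add: l2_ip_const_right l2_ip_poly_mult l2_fps_poly_mult h_l2 w' f')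
    also have "l2_ip F' (k w) = f w"
      by (simp add: k_def l2_ip_geometric f')
    finally show "dbr_ip f (\<lambda>z. dbr_kernel b z w) = f w"
      by (simp add: f')
  qed
qed

lemma dbr_space_repD:
  assumes "is_dbr_space b H ip" "\<And>z. cmod z < 1 \<Longrightarrow> b z = poly B z / poly Q z" "f \<in> H"
  obtains F G where "dbr_rep f F G"
  using rkhs_unique[OF assms(1)[unfolded is_dbr_space_def] rkhs_dbr_model[OF assms(2)] assms(3)]
  by (auto simp: dbr_model_def)

lemma dbr_space_repI:
  assumes "is_dbr_space b H ip" "\<And>z. cmod z < 1 \<Longrightarrow> b z = poly B z / poly Q z" "dbr_rep f F G"
  shows "f \<in> H" "(ip_norm ip f)\<^sup>2 = l2_sq F + l2_sq G"
proof -
  have *: "f \<in> H \<and> ip_norm ip f = ip_norm dbr_ip f"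
    using rkhs_unique[OF rkhs_dbr_model[OF assms(2)] assms(1)[unfolded is_dbr_space_def]] assms(3)
    by (auto simp: dbr_model_def)
  then show "f \<in> H" ..
  have "0 \<le> l2_sq F + l2_sq G"
    using assms(3) by (simp add: dbr_rep_def l2_sq_nonneg)
  then show "(ip_norm ip f)\<^sup>2 = l2_sq F + l2_sq G"
    using * dbr_norm_sq[OF assms(3)] by (simp add: ip_norm_def)
qed

end

section \<open>The correlation series\<close>

text \<open>As a relation it records convergence and values together. The inner sums are collected
  as coefficients of a series \<open>G\<close>, so that it can be compared with the partner of
  \<open>F\<close>.\<close>

definition corr_sums :: "complex fps \<Rightarrow> complex fps \<Rightarrow> complex fps \<Rightarrow> bool" where
  "corr_sums \<Phi> F G \<longleftrightarrow> (\<forall>m. (\<lambda>n. cnj (\<Phi> $ n) * F $ (m + n)) sums (G $ m))"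

lemma corr_sums_add: "corr_sums \<Phi> F G \<Longrightarrow> corr_sums \<Psi> F G' \<Longrightarrow> corr_sums (\<Phi> + \<Psi>) F (G + G')"
  unfolding corr_sums_def by (auto simp: distrib_right intro: sums_add)

lemma corr_sums_const_mult:
  "corr_sums \<Phi> F G \<Longrightarrow> corr_sums (fps_const c * \<Phi>) F (fps_const (cnj c) * G)"
  unfolding corr_sums_def by (auto simp: mult.assoc intro: sums_mult)

text \<open>Multiplying \<Phi> by \<open>z\<close> only replaces the sum at \<open>m\<close> by the
  sum at \<open>m + 1\<close>. Each polynomial is reached by finitely many shifts and additions, for
  which conditional convergence suffices.\<close>

lemma corr_sums_poly_mult:
  assumes "corr_sums \<Phi> F G"
  shows "corr_sums (fps_of_poly p * \<Phi>) F (adj_mult p G)"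
proof (induction p)
  case 0
  then show ?case
    by (simp add: corr_sums_def)
next
  case (pCons a p)
  have "corr_sums (fps_X * (fps_of_poly p * \<Phi>)) F (fps_shift 1 (adj_mult p G))"
    unfolding corr_sums_def
  proof
    fix m
    have "(\<lambda>n. cnj ((fps_of_poly p * \<Phi>) $ n) * F $ (Suc m + n)) sums (adj_mult p G $ Suc m)"
      using pCons.IH unfolding corr_sums_def by blast
    then have "(\<lambda>n. cnj ((fps_X * (fps_of_poly p * \<Phi>)) $ Suc n) * F $ (m + Suc n))
        sums (fps_shift 1 (adj_mult p G) $ m)"
      by simp
    \<comment> \<open>The term with index 0 is restored; it vanishes because of the factor
      \<open>fps_X\<close>.\<close>
    then show "(\<lambda>n. cnj ((fps_X * (fps_of_poly p * \<Phi>)) $ n) * F $ (m + n))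
        sums (fps_shift 1 (adj_mult p G) $ m)"
      by (subst (asm) sums_Suc_iff) simp
  qed
  moreover have "fps_of_poly (pCons a p) * \<Phi> = fps_const a * \<Phi> + fps_X * (fps_of_poly p * \<Phi>)"
    by (simp add: fps_of_poly_pCons algebra_simps)
  ultimately show ?case
    using corr_sums_add[OF corr_sums_const_mult[OF assms, of a]]
    by (simp add: adj_mult_pCons adj_mult_linear)
qed

lemma corr_sums_poly: "corr_sums (fps_of_poly p) F (adj_mult p F)"
proof -
  have "(\<lambda>n. cnj ((1 :: complex fps) $ n) * F $ (m + n)) sums (F $ m)" for m
    using sums_finite[of "{0}" "\<lambda>n. cnj ((1 :: complex fps) $ n) * F $ (m + n)"] by simp
  then show ?thesis
    using corr_sums_poly_mult[of 1 F F p] by (simp add: corr_sums_def)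
qed

lemma corr_sums_unique: "corr_sums \<Phi> F G \<Longrightarrow> corr_sums \<Phi> F G' \<Longrightarrow> G = G'"
  unfolding corr_sums_def fps_eq_iff using sums_unique2 by blast

text \<open>This is Young's inequality for an \<open>l^1\<close> and an \<open>l^2\<close> sequence.
  The estimate is made on finite sections, which gives the bound \<open>S * (S * l2_sq F)\<close>
  independently of \<open>M\<close> and \<open>N\<close>, and then \<open>N\<close> and
  \<open>M\<close> grow in turn.\<close>

lemma corr_sums_l1:
  assumes \<Phi>: "summable (\<lambda>n. cmod (\<Phi> $ n))" and F: "l2_fps F"
  obtains G where "l2_fps G" "corr_sums \<Phi> F G"
proof -
  define S where "S = (\<Sum>n. cmod (\<Phi> $ n))"
  define a where "a m n = cnj (\<Phi> $ n) * F $ (m + n)" for m n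
  define G where "G = Abs_fps (\<lambda>m. \<Sum>n. a m n)"
  have S: "(\<Sum>n<N. cmod (\<Phi> $ n)) \<le> S" for N
    unfolding S_def using \<Phi> by (intro sum_le_suminf) auto
  have "S \<ge> 0"
    using S[of 0] by simp
  have sums: "a m sums (G $ m)" for m
  proof -
    have "summable (a m)"
    proof (rule summable_comparison_test')
      show "summable (\<lambda>n. cmod (\<Phi> $ n) * sqrt (l2_sq F))"
        using \<Phi> by (rule summable_mult2)
      show "norm (a m n) \<le> cmod (\<Phi> $ n) * sqrt (l2_sq F)" for n
        unfolding a_def norm_mult complex_mod_cnj
        by (intro mult_left_mono real_le_rsqrt nth_le_l2_sq F norm_ge_zero)
    qed
    then show ?thesis
      by (simp add: G_def summable_sums)
  qed
  have partial: "(\<Sum>m<M. (cmod (\<Sum>n<N. a m n))\<^sup>2) \<le> S * (S * l2_sq F)" for M N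
  proof -
    have "(cmod (\<Sum>n<N. a m n))\<^sup>2 \<le> S * (\<Sum>n<N. cmod (\<Phi> $ n) * (cmod (F $ (m + n)))\<^sup>2)" for m
    proof -
      \<comment> \<open>Half of the weight \<open>cmod (\<Phi> $ n)\<close> goes to each factor, so
        that Cauchy-Schwarz leaves the weight to the first power in both sums.\<close>
      have "cmod (\<Sum>n<N. a m n) \<le> (\<Sum>n<N. sqrt (cmod (\<Phi> $ n)) * (sqrt (cmod (\<Phi> $ n)) * cmod (F $ (m + n))))"
        by (rule order_trans[OF norm_sum]) (simp add: a_def norm_mult flip: mult.assoc)
      then have "(cmod (\<Sum>n<N. a m n))\<^sup>2
          \<le> (\<Sum>n<N. sqrt (cmod (\<Phi> $ n)) * (sqrt (cmod (\<Phi> $ n)) * cmod (F $ (m + n))))\<^sup>2"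
        by (rule power_mono) simp
      also have "\<dots> \<le> (\<Sum>n<N. (sqrt (cmod (\<Phi> $ n)))\<^sup>2) *
          (\<Sum>n<N. (sqrt (cmod (\<Phi> $ n)) * cmod (F $ (m + n)))\<^sup>2)"
        by (rule Cauchy_Schwarz_ineq_sum)
      also have "\<dots> \<le> S * (\<Sum>n<N. cmod (\<Phi> $ n) * (cmod (F $ (m + n)))\<^sup>2)"
        using S[of N] by (auto simp: power_mult_distrib intro!: mult_right_mono sum_nonneg)
      finally show ?thesis .
    qed
    then have "(\<Sum>m<M. (cmod (\<Sum>n<N. a m n))\<^sup>2)
        \<le> (\<Sum>m<M. S * (\<Sum>n<N. cmod (\<Phi> $ n) * (cmod (F $ (m + n)))\<^sup>2))"
      by (intro sum_mono)
    also have "\<dots> = S * (\<Sum>n<N. cmod (\<Phi> $ n) * (\<Sum>m<M. (cmod (F $ (m + n)))\<^sup>2))"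
      unfolding sum_distrib_left by (rule sum.swap)
    also have "\<dots> \<le> S * (\<Sum>n<N. cmod (\<Phi> $ n) * l2_sq F)"
    proof (intro mult_left_mono sum_mono)
      fix n
      have "(\<Sum>m<M. (cmod (F $ (m + n)))\<^sup>2) = (\<Sum>k\<in>{n..<M + n}. (cmod (F $ k))\<^sup>2)"
        by (rule sum.reindex_bij_witness[of _ "\<lambda>k. k - n" "\<lambda>m. m + n"]) auto
      also have "\<dots> \<le> l2_sq F"
        unfolding l2_sq_def using F by (intro sum_le_suminf) (auto simp: l2_fps_def)
      finally show "(\<Sum>m<M. (cmod (F $ (m + n)))\<^sup>2) \<le> l2_sq F" .
    qed (use \<open>S \<ge> 0\<close> in auto)
    also have "\<dots> \<le> S * (S * l2_sq F)"
      using S[of N] \<open>S \<ge> 0\<close> l2_sq_nonneg[OF F]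
      by (auto simp flip: sum_distrib_right intro!: mult_left_mono mult_right_mono)
    finally show ?thesis .
  qed
  have "(\<Sum>m<M. (cmod (G $ m))\<^sup>2) \<le> S * (S * l2_sq F)" for M
  proof (rule LIMSEQ_le_const2)
    show "(\<lambda>N. \<Sum>m<M. (cmod (\<Sum>n<N. a m n))\<^sup>2) \<longlonglongrightarrow> (\<Sum>m<M. (cmod (G $ m))\<^sup>2)"
      using sums unfolding sums_def by (intro tendsto_intros) auto
  qed (use partial in blast)
  then have "l2_fps G"
    unfolding l2_fps_def by (intro summableI_nonneg_bounded) auto
  moreover have "corr_sums \<Phi> F G"
    using sums unfolding corr_sums_def a_def by blast
  ultimately show ?thesis
    by (rule that)
qed

section \<open>Simple poles on the circle and partial fractions\<close>

lemma inverse_linear_fps: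
  fixes \<zeta> :: complex
  assumes "\<zeta> \<noteq> 0"
  shows "inverse (fps_of_poly [:- \<zeta>, 1:]) = fps_const (- inverse \<zeta>) * Abs_fps (\<lambda>n. inverse \<zeta> ^ n)"
proof (rule fps_inverse_unique)
  have "fps_of_poly [:- \<zeta>, 1:] * fps_const (- inverse \<zeta>) = fps_of_poly (smult (- inverse \<zeta>) [:- \<zeta>, 1:])"
    by (simp only: fps_of_poly_smult mult.commute)
  also have "smult (- inverse \<zeta>) [:- \<zeta>, 1:] = [:1, - inverse \<zeta>:]"
    using assms by simp
  finally show "fps_of_poly [:- \<zeta>, 1:] * (fps_const (- inverse \<zeta>) * Abs_fps (\<lambda>n. inverse \<zeta> ^ n)) = 1"
    by (simp only: mult.assoc[symmetric] fps_of_poly_mult_geometric)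
qed

text \<open>The coefficients of \<open>1 / (z - \<zeta>)\<close> are unimodular, so square
  summability of \<open>F\<close> alone would not give convergence. The equation for
  \<open>F\<close> turns the series into a telescoping one, and \<open>w $ n\<close> tends to
  0.\<close>

lemma corr_sums_simple_pole:
  assumes \<zeta>: "cmod \<zeta> = 1" and w: "l2_fps w" and d: "d \<noteq> 0"
    and F: "fps_const d * F = adj_mult [:- \<zeta>, 1:] w"
  obtains G where "l2_fps G" "corr_sums (inverse (fps_of_poly [:- \<zeta>, 1:])) F G"
proof -
  have inv: "inverse \<zeta> = cnj \<zeta>"
    using complex_norm_square[of \<zeta>] \<zeta> by (auto intro: inverse_unique)
  have \<zeta>0: "\<zeta> \<noteq> 0"
    using \<zeta> by auto
  have "corr_sums (Abs_fps (\<lambda>n. inverse \<zeta> ^ n)) F (fps_const (- cnj \<zeta> / d) * w)"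
    unfolding corr_sums_def
  proof
    fix m
    \<comment> \<open>\<open>t\<close> is a primitive:
      \<open>t (Suc n) - t n = \<zeta> ^ n * F $ (m + n)\<close>, because
      \<open>cnj \<zeta> * \<zeta> ^ Suc n = \<zeta> ^ n\<close>. The sum is therefore
      \<open>- t 0\<close>.\<close>
    define t where "t n = cnj \<zeta> * \<zeta> ^ n * w $ (m + n) / d" for n
    have "(\<lambda>n. cmod (w $ (n + m)) / cmod d) \<longlonglongrightarrow> 0 / cmod d"
      using LIMSEQ_ignore_initial_segment[OF l2_fps_tendsto_0[OF w]] d
      by (intro tendsto_intros tendsto_norm_zero) auto
    then have "(\<lambda>n. cmod (t n)) \<longlonglongrightarrow> 0"
      using \<zeta> by (simp add: t_def norm_mult norm_divide norm_power add.commute)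
    then have "t \<longlonglongrightarrow> 0"
      by (simp add: tendsto_norm_zero_iff)
    then have "(\<lambda>n. t (Suc n) - t n) sums (0 - t 0)"
      by (rule telescope_sums)
    moreover have "t (Suc n) - t n = \<zeta> ^ n * F $ (m + n)" for n
    proof -
      have "d * F $ (m + n) = w $ (m + Suc n) - cnj \<zeta> * w $ (m + n)"
        using arg_cong[OF F, of "\<lambda>u. u $ (m + n)"] by (simp add: adj_mult_pCons)
      then have "\<zeta> ^ n * F $ (m + n) = \<zeta> ^ n * (w $ (m + Suc n) - cnj \<zeta> * w $ (m + n)) / d"
        using d by (metis nonzero_mult_div_cancel_left times_divide_eq_right)
      moreover have "cnj \<zeta> * \<zeta> ^ Suc n = \<zeta> ^ n"
        using \<zeta>0 by (simp flip: inv)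
      ultimately show ?thesis
        by (simp add: t_def algebra_simps diff_divide_distrib del: power_Suc)
    qed
    ultimately show "(\<lambda>n. cnj (Abs_fps (\<lambda>n. inverse \<zeta> ^ n) $ n) * F $ (m + n))
        sums ((fps_const (- cnj \<zeta> / d) * w) $ m)"
      by (simp add: t_def inv)
  qed
  from corr_sums_const_mult[OF this, of "- inverse \<zeta>"] show ?thesis
    using that w unfolding inverse_linear_fps[OF \<zeta>0] by (blast intro: l2_fps_const_mult)
qed

text \<open>
  Splitting off the simple poles on the circle one at a time leaves a rational function without
  poles in the closed disk, whose Taylor coefficients are absolutely summable.
\<close>

lemma corr_sums_rational:
  assumes F: "l2_fps F"
    and "\<And>z. cmod z < 1 \<Longrightarrow> poly q z \<noteq> 0"
    and "\<And>\<zeta>. cmod \<zeta> = 1 \<Longrightarrow> poly q \<zeta> = 0 \<Longrightarrow> \<not> [:- \<zeta>, 1:]\<^sup>2 dvd q \<and>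
      (\<exists>G. l2_fps G \<and> corr_sums (inverse (fps_of_poly [:- \<zeta>, 1:])) F G)"
  shows "\<exists>G. l2_fps G \<and> corr_sums (fps_of_poly p * inverse (fps_of_poly q)) F G"
  using assms(2,3)
proof (induction "degree q" arbitrary: p q rule: less_induct)
  case less
  show ?case
  proof (cases "\<exists>\<zeta>. cmod \<zeta> = 1 \<and> poly q \<zeta> = 0")
    case False
    then have "\<And>z. cmod z \<le> 1 \<Longrightarrow> poly q z \<noteq> 0"
      using less.prems(1) by (auto simp: le_less)
    then have "summable (\<lambda>n. cmod ((fps_of_poly p * inverse (fps_of_poly q)) $ n))"
      by (intro conv_radius_gt_1_summable inverse_poly_fps_conv_radius)
    then show ?thesis
      using corr_sums_l1 F by blast
  next
    case True
    then obtain \<zeta> where \<zeta>: "cmod \<zeta> = 1" "poly q \<zeta> = 0"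
      by blast
    define l where "l = [:- \<zeta>, 1:]"
    obtain r where r: "q = l * r"
      using \<zeta>(2) unfolding l_def poly_eq_0_iff_dvd by blast
    have q0: "q \<noteq> 0"
      using less.prems(1)[of 0] by auto
    have "\<not> l * l dvd l * r"
      using less.prems(2)[OF \<zeta>] unfolding l_def[symmetric] r power2_eq_square by blast
    then have "poly r \<zeta> \<noteq> 0"
      unfolding poly_eq_0_iff_dvd l_def[symmetric] using mult_dvd_mono[OF dvd_refl] by blast
    \<comment> \<open>\<open>c\<close> is the residue of \<open>p / q\<close> at \<zeta>: with
      \<open>p - c * r = l * p'\<close> one gets \<open>p / q = c / l + p' / r\<close>.\<close>
    define c where "c = poly p \<zeta> / poly r \<zeta>"
    have "poly (p - smult c r) \<zeta> = 0"
      using \<open>poly r \<zeta> \<noteq> 0\<close> by (simp add: c_def)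
    then obtain p' where p': "p - smult c r = l * p'"
      unfolding poly_eq_0_iff_dvd l_def by blast
    obtain G where G: "l2_fps G" "corr_sums (inverse (fps_of_poly l)) F G"
      using less.prems(2)[OF \<zeta>] unfolding l_def by blast
    have "\<exists>G. l2_fps G \<and> corr_sums (fps_of_poly p' * inverse (fps_of_poly r)) F G"
    proof (rule less.hyps)
      show "degree r < degree q"
        using q0 unfolding r by (subst degree_mult_eq) (auto simp: l_def)
      show "poly r z \<noteq> 0" if "cmod z < 1" for z
        using less.prems(1)[OF that] by (auto simp: r)
      show "\<not> [:- z, 1:]\<^sup>2 dvd r \<and> (\<exists>G. l2_fps G \<and> corr_sums (inverse (fps_of_poly [:- z, 1:])) F G)"
        if "cmod z = 1" "poly r z = 0" for z
        using less.prems(2)[OF that(1)] that(2) unfolding r by (auto intro: dvd_mult)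
    qed
    then obtain G' where G': "l2_fps G'" "corr_sums (fps_of_poly p' * inverse (fps_of_poly r)) F G'"
      by blast
    have nz: "fps_of_poly l $ 0 \<noteq> 0" "fps_of_poly r $ 0 \<noteq> 0"
      using less.prems(1)[of 0] by (auto simp: r poly_0_coeff_0 coeff_mult)
    have "p = smult c r + l * p'"
      using p' by (simp add: algebra_simps)
    then have "fps_of_poly p * inverse (fps_of_poly q)
        = (fps_const c * fps_of_poly r + fps_of_poly l * fps_of_poly p') *
          (inverse (fps_of_poly l) * inverse (fps_of_poly r))"
      by (simp add: r fps_of_poly_mult fps_of_poly_add fps_of_poly_smult fps_inverse_mult)
    also have "\<dots> = fps_const c * inverse (fps_of_poly l) * (fps_of_poly r * inverse (fps_of_poly r))
        + fps_of_poly p' * inverse (fps_of_poly r) * (fps_of_poly l * inverse (fps_of_poly l))"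
      by (simp add: algebra_simps)
    also have "\<dots> = fps_const c * inverse (fps_of_poly l) + fps_of_poly p' * inverse (fps_of_poly r)"
      using nz by (simp add: inverse_mult_eq_1')
    finally have eq: "fps_of_poly p * inverse (fps_of_poly q)
        = fps_const c * inverse (fps_of_poly l) + fps_of_poly p' * inverse (fps_of_poly r)" .
    show ?thesis
      unfolding eq using corr_sums_add[OF corr_sums_const_mult[OF G(2), of c] G'(2)] G(1) G'(1)
      by (blast intro: l2_fps_add l2_fps_const_mult)
  qed
qed

section \<open>Correlation with the coefficients of \<open>B / A\<close>\<close>

context pythagorean_polys
begin

abbreviation \<Phi> :: "complex fps" where
  "\<Phi> \<equiv> fps_of_poly B * inverse (fps_of_poly A)"

lemma A_mult_\<Phi>: "fps_of_poly A * \<Phi> = fps_of_poly B"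
proof -
  have "fps_of_poly A $ 0 \<noteq> 0"
    using A_nonzero[of 0] by (simp add: poly_0_coeff_0)
  then have "fps_of_poly A * inverse (fps_of_poly A) = 1"
    by (rule inverse_mult_eq_1')
  then show ?thesis
    by (metis mult.left_commute mult.right_neutral)
qed

lemma eval_\<Phi>: "cmod z < 1 \<Longrightarrow> eval_fps \<Phi> z = poly B z / poly A z"
  by (rule inverse_poly_fps(2)[OF A_nonzero]) auto

text \<open>No zero of \<open>A\<close> on the circle is cancelled by \<open>B\<close>, although the
  two need not be coprime elsewhere. So the multiplicities of these zeros are the pole
  orders.\<close>

lemma B_nonzero_at_root: "cmod \<zeta> = 1 \<Longrightarrow> poly A \<zeta> = 0 \<Longrightarrow> poly B \<zeta> \<noteq> 0"
  using circle[of \<zeta>] Q_nonzero[of \<zeta>] by auto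

lemma dbr_rep_if_corr_sums:
  assumes "l2_fps F" "l2_fps G" "corr_sums \<Phi> F G" "\<And>z. cmod z < 1 \<Longrightarrow> f z = eval_fps F z"
  shows "dbr_rep f F G"
proof -
  have "corr_sums (fps_of_poly B) F (adj_mult A G)"
    using corr_sums_poly_mult[OF assms(3), of A] by (simp only: A_mult_\<Phi>)
  then show ?thesis
    using corr_sums_unique[OF corr_sums_poly] assms by (auto simp: dbr_rep_def)
qed

lemma corr_sums_if_dbr_rep:
  assumes simple: "\<And>\<zeta>. cmod \<zeta> = 1 \<Longrightarrow> \<not> [:- \<zeta>, 1:]\<^sup>2 dvd A"
    and f: "dbr_rep f F G"
  shows "\<exists>G. l2_fps G \<and> corr_sums \<Phi> F G"
proof (rule corr_sums_rational)
  have l2: "l2_fps F" "l2_fps G" and eq: "adj_mult B F = adj_mult A G"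
    using f by (auto simp: dbr_rep_def)
  show "l2_fps F"
    by fact
  fix \<zeta>
  assume \<zeta>: "cmod \<zeta> = 1" "poly A \<zeta> = 0"
  define l where "l = [:- \<zeta>, 1:]"
  obtain R where R: "A = l * R"
    using \<zeta>(2) unfolding l_def poly_eq_0_iff_dvd by blast
  \<comment> \<open>Apart from its value at \<zeta>, \<open>B\<close> is divisible by
    \<open>l\<close>, and so is \<open>A\<close>. Hence a nonzero multiple of \<open>F\<close>
    itself lies in the range of \<open>adj_mult l\<close>.\<close>
  have "poly (B - [:poly B \<zeta>:]) \<zeta> = 0"
    by simp
  then obtain S where S: "B - [:poly B \<zeta>:] = l * S"
    unfolding l_def poly_eq_0_iff_dvd by blast
  have "B = [:poly B \<zeta>:] + l * S"
    using S by (simp add: algebra_simps)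
  then have "adj_mult B F = fps_const (cnj (poly B \<zeta>)) * F + adj_mult l (adj_mult S F)"
    by (metis adj_mult_add_poly adj_mult_mult adj_mult_pCons adj_mult_0 add.right_neutral)
  moreover have "adj_mult A G = adj_mult l (adj_mult R G)"
    unfolding R adj_mult_mult ..
  ultimately have "fps_const (cnj (poly B \<zeta>)) * F = adj_mult l (adj_mult R G - adj_mult S F)"
    using eq by (simp add: adj_mult_linear algebra_simps)
  then have "\<exists>G. l2_fps G \<and> corr_sums (inverse (fps_of_poly [:- \<zeta>, 1:])) F G"
    using corr_sums_simple_pole[OF \<zeta>(1), of "adj_mult R G - adj_mult S F" "cnj (poly B \<zeta>)" F]
      B_nonzero_at_root[OF \<zeta>] l2
    by (metis complex_cnj_zero_iff l2_fps_adj_mult l2_fps_diff l_def)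
  then show "\<not> [:- \<zeta>, 1:]\<^sup>2 dvd A \<and> (\<exists>G. l2_fps G \<and> corr_sums (inverse (fps_of_poly [:- \<zeta>, 1:])) F G)"
    using simple \<zeta>(1) by blast
qed (rule A_nonzero)

text \<open>Coefficients bounded by \<open>M\<close> give modulus at most \<open>M / (1 - r)\<close>
  at \<open>r * \<zeta>\<close>. There \<open>A\<close> is of size \<open>(1 - r)^2\<close>, so
  \<open>B\<close>, the product, would vanish at \<zeta>.\<close>

lemma \<Phi>_unbounded:
  assumes \<zeta>: "cmod \<zeta> = 1" "[:- \<zeta>, 1:]\<^sup>2 dvd A"
  shows "\<exists>n\<ge>N. cmod (\<Phi> $ n) \<ge> C"
proof (rule ccontr)
  assume neg: "\<not> ?thesis"
  \<comment> \<open>The finitely many coefficients before \<open>N\<close> are covered by the inner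
    maximum; the 0 keeps its set nonempty when \<open>N = 0\<close>.\<close>
  define M where "M = max C (Max (insert 0 ((\<lambda>n. cmod (\<Phi> $ n)) ` {..<N})))"
  have M: "cmod (\<Phi> $ n) \<le> M" for n
  proof (cases "n < N")
    case True
    then have "cmod (\<Phi> $ n) \<le> Max (insert 0 ((\<lambda>n. cmod (\<Phi> $ n)) ` {..<N}))"
      by (intro Max_ge) auto
    then show ?thesis
      by (simp add: M_def)
  next
    case False
    then have "cmod (\<Phi> $ n) < C"
      using neg by (auto simp: not_le)
    then show ?thesis
      by (simp add: M_def)
  qed
  obtain R where R: "A = [:- \<zeta>, 1:]\<^sup>2 * R"
    using \<zeta>(2) by blast
  then have "poly A \<zeta> = 0"
    by simp
  have bound: "cmod (poly B (of_real r * \<zeta>)) \<le> (1 - r) * (cmod (poly R (of_real r * \<zeta>)) * M)"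
    if r: "0 < r" "r < 1" for r :: real
  proof -
    define z where "z = of_real r * \<zeta>"
    have z: "cmod z = r"
      using r \<zeta> by (simp add: z_def norm_mult)
    have geo: "summable (\<lambda>n. M * r ^ n)" "(\<Sum>n. M * r ^ n) = M * (1 / (1 - r))"
      using r by (auto intro!: summable_mult summable_geometric simp: suminf_mult suminf_geometric summable_geometric)
    have term_le: "norm (\<Phi> $ n * z ^ n) \<le> M * r ^ n" for n
      using M[of n] r by (simp add: norm_mult norm_power z mult_right_mono)
    have abs: "summable (\<lambda>n. norm (\<Phi> $ n * z ^ n))"
      using term_le by (intro summable_comparison_test'[OF geo(1)]) simp
    have "cmod (eval_fps \<Phi> z) \<le> (\<Sum>n. norm (\<Phi> $ n * z ^ n))"
      unfolding eval_fps_def using abs by (rule summable_norm)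
    also have "\<dots> \<le> M * (1 / (1 - r))"
      unfolding geo(2)[symmetric] using term_le abs geo(1) by (rule suminf_le)
    finally have eval_le: "cmod (eval_fps \<Phi> z) \<le> M / (1 - r)"
      by simp
    have "poly B z = poly A z * eval_fps \<Phi> z"
      using eval_\<Phi>[of z] A_nonzero[of z] r z by simp
    also have "poly A z = (of_real (r - 1) * \<zeta>)\<^sup>2 * poly R z"
      by (simp add: R poly_power z_def algebra_simps)
    finally have "cmod (poly B z) = (1 - r)\<^sup>2 * cmod (poly R z) * cmod (eval_fps \<Phi> z)"
      using \<zeta> r by (simp add: norm_mult norm_power power2_commute del: of_real_diff)
    also have "\<dots> \<le> (1 - r)\<^sup>2 * cmod (poly R z) * (M / (1 - r))"
      using eval_le by (intro mult_left_mono) auto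
    also have "\<dots> = (1 - r) * (cmod (poly R z) * M)"
      using r by (simp add: power2_eq_square)
    finally show ?thesis
      by (simp add: z_def)
  qed
  have id: "((\<lambda>r::real. r) \<longlongrightarrow> 1) (at_left 1)"
    by (rule tendsto_ident_at)
  have "((\<lambda>r::real. cmod (poly B (of_real r * \<zeta>))) \<longlongrightarrow> cmod (poly B (of_real 1 * \<zeta>))) (at_left 1)"
    by (intro tendsto_intros id)
  moreover have "((\<lambda>r::real. (1 - r) * (cmod (poly R (of_real r * \<zeta>)) * M))
      \<longlongrightarrow> (1 - 1) * (cmod (poly R (of_real 1 * \<zeta>)) * M)) (at_left 1)"
    by (intro tendsto_intros id)
  moreover have "\<forall>\<^sub>F r::real in at_left 1. r \<in> {0<..<1}"
    by (rule eventually_at_leftI[of 0]) auto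
  then have "\<forall>\<^sub>F r::real in at_left 1. cmod (poly B (of_real r * \<zeta>)) \<le> (1 - r) * (cmod (poly R (of_real r * \<zeta>)) * M)"
    by eventually_elim (use bound in auto)
  ultimately have "cmod (poly B (of_real 1 * \<zeta>)) \<le> (1 - 1) * (cmod (poly R (of_real 1 * \<zeta>)) * M)"
    by (intro tendsto_le[of "at_left (1::real)"]) auto
  then show False
    using B_nonzero_at_root[OF \<zeta>(1) \<open>poly A \<zeta> = 0\<close>] by simp
qed

text \<open>
  Every \<open>adj_mult A u\<close> belongs to the space. For \<open>u\<close> supported on a sufficiently sparse set of
  indices along which the coefficients of \<open>\<Phi>\<close> blow up, the terms of the series do not tend to \<open>0\<close>.
\<close>

lemma exists_divergent:
  assumes \<zeta>: "cmod \<zeta> = 1" "[:- \<zeta>, 1:]\<^sup>2 dvd A"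
  obtains F G where "dbr_rep (eval_fps F) F G" "\<not> summable (\<lambda>n. cnj (\<Phi> $ n) * F $ n)"
proof -
  define d where "d = degree A"
  \<comment> \<open>The growth \<open>2 ^ k\<close> makes the reciprocals square summable. Gaps
    larger than the degree of \<open>A\<close> ensure that the coefficient of
    \<open>adj_mult A u\<close> at \<open>s k\<close> sees only the entry of \<open>u\<close> at
    \<open>s k\<close>.\<close>
  have "\<exists>s. \<forall>k. cmod (\<Phi> $ (s k)) \<ge> 2 ^ k \<and> s (Suc k) > s k + d"
  proof (rule dependent_nat_choice)
    show "\<exists>x. 2 ^ 0 \<le> cmod (\<Phi> $ x)"
      using \<Phi>_unbounded[OF \<zeta>, of 0 "2 ^ 0"] by blast
    show "\<exists>y. 2 ^ Suc k \<le> cmod (\<Phi> $ y) \<and> x + d < y" for x k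
      using \<Phi>_unbounded[OF \<zeta>, of "Suc (x + d)" "2 ^ Suc k"] by (auto simp: Suc_le_eq)
  qed
  then obtain s where s: "\<And>k. cmod (\<Phi> $ (s k)) \<ge> 2 ^ k" "\<And>k. s (Suc k) > s k + d"
    by blast
  have mono: "strict_mono s"
    using s(2) by (intro strict_monoI_Suc) (meson le_add1 le_less_trans)
  \<comment> \<open>With these reciprocals every term of the series at an index \<open>s k\<close>
    has modulus \<open>cmod (coeff A 0)\<close>.\<close>
  define u where "u = Abs_fps (\<lambda>n. if n \<in> range s then inverse (\<Phi> $ n) else 0)"
  have "summable (\<lambda>k. (cmod (u $ s k))\<^sup>2)"
  proof (rule summable_comparison_test')
    show "summable (\<lambda>k. (1 / 2 :: real) ^ k)"
      by simp
    show "norm ((cmod (u $ s k))\<^sup>2) \<le> (1 / 2) ^ k" for k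
    proof -
      have le: "cmod (u $ s k) \<le> (1 / 2) ^ k"
        using le_imp_inverse_le[OF s(1)[of k]]
        by (simp add: u_def norm_inverse power_one_over inverse_eq_divide norm_divide)
      moreover have "(1 / 2 :: real) ^ k \<le> 1"
        by (simp add: power_le_one)
      ultimately have "cmod (u $ s k) * cmod (u $ s k) \<le> (1 / 2) ^ k * 1"
        by (intro mult_mono) auto
      then show ?thesis
        by (simp add: power2_eq_square)
    qed
  qed
  then have u: "l2_fps u"
    unfolding l2_fps_def
    by (subst (asm) summable_mono_reindex[OF mono, of "\<lambda>n. (cmod (u $ n))\<^sup>2"]) (auto simp: u_def)
  define F where "F = adj_mult A u"
  \<comment> \<open>The partner of \<open>adj_mult A u\<close> is \<open>adj_mult B u\<close>,
    because the two operators commute.\<close>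
  have rep: "dbr_rep (eval_fps F) F (adj_mult B u)"
    unfolding dbr_rep_def F_def using u
    by (simp add: l2_fps_adj_mult mult.commute flip: adj_mult_mult)
  have gap: "s k + i \<notin> range s" if i: "0 < i" "i \<le> d" for k i
  proof
    assume "s k + i \<in> range s"
    then obtain j where j: "s k + i = s j"
      by auto
    then have "s k < s j"
      using i by simp
    then have "Suc k \<le> j"
      using mono by (simp add: strict_mono_less Suc_le_eq)
    then have "s (Suc k) \<le> s j"
      using mono by (simp add: strict_mono_less_eq)
    then show False
      using s(2)[of k] j i by simp
  qed
  have F_s: "F $ s k = cnj (coeff A 0) * inverse (\<Phi> $ s k)" for k
  proof -
    have "F $ s k = (\<Sum>i\<le>d. cnj (coeff A i) * u $ (s k + i))"
      unfolding F_def by (rule adj_mult_nth) (simp add: d_def)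
    also have "\<dots> = (\<Sum>i\<in>{0}. cnj (coeff A i) * u $ (s k + i))"
      by (rule sum.mono_neutral_right) (use gap in \<open>auto simp: u_def\<close>)
    finally show ?thesis
      by (simp add: u_def)
  qed
  have A0: "coeff A 0 \<noteq> 0"
    using A_nonzero[of 0] by (simp add: poly_0_coeff_0)
  have "\<not> summable (\<lambda>n. cnj (\<Phi> $ n) * F $ n)"
  proof
    assume "summable (\<lambda>n. cnj (\<Phi> $ n) * F $ n)"
    then have "(\<lambda>n. cmod (cnj (\<Phi> $ n) * F $ n)) \<longlonglongrightarrow> 0"
      by (intro tendsto_norm_zero summable_LIMSEQ_zero)
    from LIMSEQ_subseq_LIMSEQ[OF this mono]
    have lim: "(\<lambda>k. cmod (cnj (\<Phi> $ s k) * F $ s k)) \<longlonglongrightarrow> 0"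
      by (simp add: o_def)
    have "cmod (cnj (\<Phi> $ s k) * F $ s k) = cmod (coeff A 0)" for k
    proof -
      have "\<Phi> $ s k \<noteq> 0"
        using less_le_trans[OF zero_less_power[of "2::real" k] s(1)[of k]] by auto
      then show ?thesis
        unfolding F_s by (simp add: norm_mult norm_inverse)
    qed
    then show False
      using lim A0 by (simp add: LIMSEQ_const_iff)
  qed
  with rep show ?thesis
    by (rule that)
qed

end

section \<open>Hardy spaces and rational functions\<close>

lemma fourier_coeff_has_integral:
  fixes f :: "complex \<Rightarrow> complex"
  assumes f: "f holomorphic_on unit_disk" "f has_fps_expansion F" and r: "0 < r" "r < 1"
  shows "((\<lambda>t. f (of_real r * cis t) * cnj (cis t) ^ n) has_integral (2 * pi * (F $ n * of_real r ^ n))) {0..2 * pi}"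
proof -
  have "((\<lambda>u. f u / (u - 0) ^ Suc n) has_contour_integral (2 * pi * \<i> / fact n * (deriv ^^ n) f 0)) (circlepath 0 r)"
    using r by (intro Cauchy_has_contour_integral_higher_derivative_circlepath holomorphic_on_imp_continuous_on
        holomorphic_on_subset[OF f(1)]) auto
  also have "2 * pi * \<i> / fact n * (deriv ^^ n) f 0 = 2 * pi * \<i> * F $ n"
    by (simp add: fps_nth_fps_expansion[OF f(2)])
  finally have "((\<lambda>t. f (0 + of_real r * cis t) / (0 + of_real r * cis t - 0) ^ Suc n * of_real r * \<i> * cis t)
      has_integral (2 * pi * \<i> * F $ n)) {0..2 * pi}"
    unfolding circlepath_def by (subst (asm) has_contour_integral_part_circlepath_iff) auto
  \<comment> \<open>The factor \<open>r ^ n / \<i>\<close> removes the powers of \<open>r\<close>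
    and the \<open>\<i>\<close> introduced by the parametrization of the circle.\<close>
  then have "((\<lambda>t. (of_real r ^ n / \<i>) *
      (f (0 + of_real r * cis t) / (0 + of_real r * cis t - 0) ^ Suc n * of_real r * \<i> * cis t))
      has_integral (of_real r ^ n / \<i> * (2 * pi * \<i> * F $ n))) {0..2 * pi}"
    by (rule has_integral_mult_right)
  moreover have "(of_real r ^ n / \<i>) *
      (f (0 + of_real r * cis t) / (0 + of_real r * cis t - 0) ^ Suc n * of_real r * \<i> * cis t)
      = f (of_real r * cis t) * cnj (cis t) ^ n" for t
  proof -
    have "cnj (cis t) ^ n = inverse (cis t ^ n)"
      unfolding cis_cnj cis_inverse[symmetric] by (rule power_inverse)
    then show ?thesis
      using r by (simp add: power_mult_distrib field_simps del: cis_cnj)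
  qed
  ultimately show ?thesis
    by (simp add: mult_ac)
qed

text \<open>This is Bessel's inequality. For the Taylor polynomial \<open>p\<close>,
  \<open>Re ((2 * f - p) * cnj p)\<close> equals \<open>|f|^2 - |f - p|^2\<close>, so it is at most
  \<open>|f|^2\<close>, and its integral is a finite combination of Taylor coefficients.\<close>

lemma hardy_2_partial_sum_le:
  assumes f: "f holomorphic_on unit_disk" "f has_fps_expansion F" and r: "0 < r" "r < 1"
  shows "2 * pi * (\<Sum>n<N. (cmod (F $ n) * r ^ n)\<^sup>2)
    \<le> integral {0..2 * pi} (\<lambda>t. cmod (f (of_real r * cis t)) powr 2)"
proof -
  define p where "p = (\<Sum>i<N. monom (F $ i) i)"
  \<comment> \<open>For \<open>n < N\<close> the coefficient of \<open>g\<close> is again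
    \<open>F $ n\<close>.\<close>
  define g where "g z = 2 * f z - poly p z" for z
  have coeff_p: "coeff p n = F $ n" if "n < N" for n
    using that by (simp add: p_def coeff_sum)
  have "poly p has_fps_expansion fps_of_poly p"
    by (simp add: has_fps_expansion_def)
  then have "g has_fps_expansion (fps_const 2 * F - fps_of_poly p)"
    unfolding g_def by (intro fps_expansion_intros f)
  moreover have "g holomorphic_on unit_disk"
    unfolding g_def by (intro holomorphic_intros f)
  ultimately have coeff: "((\<lambda>t. g (of_real r * cis t) * cnj (cis t) ^ n) has_integral
      (2 * pi * ((fps_const 2 * F - fps_of_poly p) $ n * of_real r ^ n))) {0..2 * pi}" for n
    using fourier_coeff_has_integral r by blast
  have "((\<lambda>t. \<Sum>n<N. cnj (F $ n) * of_real r ^ n * (g (of_real r * cis t) * cnj (cis t) ^ n)) has_integral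
      (\<Sum>n<N. cnj (F $ n) * of_real r ^ n * (2 * pi * ((fps_const 2 * F - fps_of_poly p) $ n * of_real r ^ n))))
      {0..2 * pi}"
    by (intro has_integral_sum has_integral_mult_right coeff) auto
  also have "(\<lambda>t. \<Sum>n<N. cnj (F $ n) * of_real r ^ n * (g (of_real r * cis t) * cnj (cis t) ^ n))
      = (\<lambda>t. g (of_real r * cis t) * cnj (poly p (of_real r * cis t)))"
    by (simp add: p_def poly_sum poly_monom sum_distrib_left power_mult_distrib mult_ac)
  also have "(\<Sum>n<N. cnj (F $ n) * of_real r ^ n * (2 * pi * ((fps_const 2 * F - fps_of_poly p) $ n * of_real r ^ n)))
      = of_real (2 * pi * (\<Sum>n<N. (cmod (F $ n) * r ^ n)\<^sup>2))"
    unfolding sum_distrib_left of_real_sum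
  proof (rule sum.cong)
    fix n
    assume "n \<in> {..<N}"
    then have "cnj (F $ n) * of_real r ^ n * (2 * pi * ((fps_const 2 * F - fps_of_poly p) $ n * of_real r ^ n))
        = 2 * pi * (F $ n * cnj (F $ n)) * (of_real r ^ n)\<^sup>2"
      by (simp add: coeff_p power2_eq_square)
    also have "\<dots> = of_real (2 * pi * (cmod (F $ n) * r ^ n)\<^sup>2)"
      by (simp add: power_mult_distrib flip: complex_norm_square)
    finally show "cnj (F $ n) * of_real r ^ n * (2 * pi * ((fps_const 2 * F - fps_of_poly p) $ n * of_real r ^ n))
        = of_real (2 * pi * (cmod (F $ n) * r ^ n)\<^sup>2)" .
  qed simp
  finally have "((\<lambda>t. Re (g (of_real r * cis t) * cnj (poly p (of_real r * cis t)))) has_integral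
      (2 * pi * (\<Sum>n<N. (cmod (F $ n) * r ^ n)\<^sup>2))) {0..2 * pi}"
    by (drule_tac has_integral_Re) simp
  moreover have "(\<lambda>t. cmod (f (of_real r * cis t)) powr 2) integrable_on {0..2 * pi}"
  proof (rule integrable_continuous_interval)
    have "continuous_on {0..2 * pi} (\<lambda>t. f (of_real r * cis t))"
      using r by (intro continuous_on_compose2[OF holomorphic_on_imp_continuous_on[OF f(1)]] continuous_intros)
        (auto simp: norm_mult)
    then show "continuous_on {0..2 * pi} (\<lambda>t. cmod (f (of_real r * cis t)) powr 2)"
      by (auto intro!: continuous_intros)
  qed
  moreover have "Re ((2 * x - y) * cnj y) \<le> cmod x powr 2" for x y
  proof -
    have "(cmod x)\<^sup>2 - Re ((2 * x - y) * cnj y) = (cmod (x - y))\<^sup>2"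
      unfolding cmod_power2 by (simp add: algebra_simps power2_eq_square)
    then have "Re ((2 * x - y) * cnj y) \<le> (cmod x)\<^sup>2"
      using zero_le_power2[of "cmod (x - y)"] by linarith
    then show ?thesis
      by simp
  qed
  ultimately show ?thesis
    using has_integral_le[OF _ integrable_integral] unfolding g_def by blast
qed

lemma hardy_2_l2:
  assumes "f \<in> hardy 2"
  shows "f has_fps_expansion fps_expansion f 0" "l2_fps (fps_expansion f 0)"
proof -
  define F where "F = fps_expansion f 0"
  have holo: "f holomorphic_on unit_disk"
    using assms by (simp add: hardy_def)
  have F: "f has_fps_expansion F"
    unfolding F_def by (rule has_fps_expansion_fps_expansion[OF _ _ holo]) auto
  then show "f has_fps_expansion fps_expansion f 0"
    by (simp add: F_def)
  define I where "I r = (1 / (2 * pi)) * integral {0..2 * pi} (\<lambda>t. cmod (f (of_real r * cis t)) powr 2)" for r :: real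
  have "bdd_above (I ` {0..<1})"
    using assms unfolding hardy_def I_def mem_Collect_eq by (rule conjunct2)
  then obtain C where C: "\<And>r. r \<in> {0..<1} \<Longrightarrow> I r \<le> C"
    unfolding bdd_above_def by blast
  \<comment> \<open>For fixed \<open>N\<close> the sum is finite, so \<open>r\<close> may tend to 1;
    the bound \<open>C\<close> does not depend on \<open>N\<close>.\<close>
  have "(\<Sum>n<N. (cmod (F $ n))\<^sup>2) \<le> C" for N
  proof (rule tendsto_upperbound)
    have "((\<lambda>r::real. \<Sum>n<N. (cmod (F $ n) * r ^ n)\<^sup>2) \<longlongrightarrow> (\<Sum>n<N. (cmod (F $ n) * 1 ^ n)\<^sup>2)) (at_left 1)"
      by (intro tendsto_intros)
    then show "((\<lambda>r::real. \<Sum>n<N. (cmod (F $ n) * r ^ n)\<^sup>2) \<longlongrightarrow> (\<Sum>n<N. (cmod (F $ n))\<^sup>2)) (at_left 1)"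
      by simp
    have "\<forall>\<^sub>F r::real in at_left 1. r \<in> {0<..<1}"
      by (rule eventually_at_leftI[of 0]) auto
    then show "\<forall>\<^sub>F r::real in at_left 1. (\<Sum>n<N. (cmod (F $ n) * r ^ n)\<^sup>2) \<le> C"
    proof eventually_elim
      case (elim r)
      then have "2 * pi * (\<Sum>n<N. (cmod (F $ n) * r ^ n)\<^sup>2)
          \<le> integral {0..2 * pi} (\<lambda>t. cmod (f (of_real r * cis t)) powr 2)"
        by (intro hardy_2_partial_sum_le[OF holo F]) auto
      then have "(\<Sum>n<N. (cmod (F $ n) * r ^ n)\<^sup>2) \<le> I r"
        by (simp add: I_def pos_le_divide_eq mult.commute)
      also have "\<dots> \<le> C"
        using elim by (intro C) auto
      finally show ?case .
    qed
  qed simp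
  then show "l2_fps (fps_expansion f 0)"
    unfolding l2_fps_def F_def[symmetric] by (intro summableI_nonneg_bounded) auto
qed

section \<open>Bounded rational functions and their boundary values\<close>

lemma eventually_not_in_finite:
  fixes z :: "'a :: t1_space"
  shows "finite T \<Longrightarrow> \<forall>\<^sub>F w in at z. w \<notin> T"
  using islimpt_finite islimpt_iff_eventually by blast

text \<open>
  A representation \<open>p / q\<close> with \<open>q\<close> of minimal degree has no zero of \<open>q\<close> in the closed disk:
  a common zero could be cancelled, and any other one contradicts boundedness.
\<close>

lemma bounded_rational_function:
  assumes r: "r \<in> hardy_inf" "rational_function r"
  obtains p q where "\<And>z. cmod z \<le> 1 \<Longrightarrow> poly q z \<noteq> 0"
    "\<And>z. cmod z < 1 \<Longrightarrow> r z = poly p z / poly q z" "finite {z. r z \<noteq> poly p z / poly q z}"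
proof -
  \<comment> \<open>A finite exceptional set is allowed: the values of \<open>r\<close> at zeros of
    the denominator are unknown, and cancelling a factor changes the quotient at its root.\<close>
  define repr where "repr = (\<lambda>(p, q). q \<noteq> 0 \<and> finite {z. r z \<noteq> poly p z / poly q z})"
  obtain p0 q0 where "q0 \<noteq> 0" "\<And>z. poly q0 z \<noteq> 0 \<Longrightarrow> r z = poly p0 z / poly q0 z"
    using r(2) unfolding rational_function_def by blast
  then have "repr (p0, q0)"
    unfolding repr_def by (auto intro: rev_finite_subset[OF poly_roots_finite[of q0]])
  then obtain p q where pq: "repr (p, q)" and
    least: "\<And>p' q'. repr (p', q') \<Longrightarrow> degree q \<le> degree q'"
    using ex_has_least_nat[of repr "(p0, q0)" "degree \<circ> snd"] by fastforce
  define T where "T = {z. r z \<noteq> poly p z / poly q z}"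
  have q0: "q \<noteq> 0" and T: "finite T"
    using pq by (auto simp: repr_def T_def)
  have r_eq: "r z = poly p z / poly q z" if "z \<notin> T" for z
    using that by (simp add: T_def)
  obtain M where M: "\<forall>z\<in>unit_disk. cmod (r z) \<le> M"
    using r(1) by (auto simp: hardy_inf_def bounded_iff)
  have holo: "r holomorphic_on unit_disk"
    using r(1) by (simp add: hardy_inf_def)
  have q_nz: "poly q \<zeta> \<noteq> 0" if \<zeta>: "cmod \<zeta> \<le> 1" for \<zeta>
  proof
    assume q\<zeta>: "poly q \<zeta> = 0"
    show False
    proof (cases "poly p \<zeta> = 0")
      case True
      obtain p' q' where p': "p = [:- \<zeta>, 1:] * p'" and q': "q = [:- \<zeta>, 1:] * q'"
        using q\<zeta> True unfolding poly_eq_0_iff_dvd by blast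
      have "{z. r z \<noteq> poly p' z / poly q' z} \<subseteq> insert \<zeta> T"
      proof
        fix z
        assume z: "z \<in> {z. r z \<noteq> poly p' z / poly q' z}"
        show "z \<in> insert \<zeta> T"
        proof (rule ccontr)
          assume "z \<notin> insert \<zeta> T"
          then have "r z = ((z - \<zeta>) * poly p' z) / ((z - \<zeta>) * poly q' z)" "z - \<zeta> \<noteq> 0"
            using r_eq[of z] by (auto simp: p' q' algebra_simps)
          then show False
            using z by simp
        qed
      qed
      then have "repr (p', q')"
        using T q0 unfolding repr_def q' by (auto intro: finite_subset)
      moreover have "degree q = Suc (degree q')"
        using q0 unfolding q' by (subst degree_mult_eq) auto
      ultimately show False
        using least by force
    next
      case False
      \<comment> \<open>Since \<zeta> may lie on the circle, the bound on the disk is passed to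
        \<zeta> from inside.\<close>
      let ?at = "at \<zeta> within unit_disk"
      have "?at \<noteq> bot"
        using \<zeta> by (simp add: trivial_limit_within islimpt_ball)
      moreover have "((\<lambda>z. cmod (poly p z)) \<longlongrightarrow> cmod (poly p \<zeta>)) ?at"
        "((\<lambda>z. M * cmod (poly q z)) \<longlongrightarrow> M * cmod (poly q \<zeta>)) ?at"
        by (intro tendsto_intros)+
      moreover have "\<forall>\<^sub>F z in ?at. cmod (poly p z) \<le> M * cmod (poly q z)"
      proof -
        have "finite (T \<union> {z. poly q z = 0})"
          using T q0 by (simp add: poly_roots_finite)
        then have "\<forall>\<^sub>F z in at \<zeta>. z \<notin> T \<union> {z. poly q z = 0}"
          by (rule eventually_not_in_finite)
        then have "\<forall>\<^sub>F z in ?at. z \<notin> T \<union> {z. poly q z = 0}"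
          by (rule filter_leD[OF at_le, rotated]) simp
        moreover have "\<forall>\<^sub>F z in ?at. z \<in> unit_disk"
          by (simp add: eventually_at_filter)
        ultimately show ?thesis
        proof eventually_elim
          case (elim z)
          then show ?case
            using M[rule_format, of z] r_eq[of z] by (simp add: norm_divide pos_divide_le_eq)
        qed
      qed
      ultimately have "cmod (poly p \<zeta>) \<le> M * cmod (poly q \<zeta>)"
        by (intro tendsto_le)
      then show False
        using q\<zeta> False by simp
    qed
  qed
  \<comment> \<open>Inside the disk both sides are continuous, so equality off a finite set extends
    to every point.\<close>
  have "r z = poly p z / poly q z" if z: "cmod z < 1" for z
  proof (rule LIM_unique)
    have "isCont r z"
      using holomorphic_on_imp_continuous_on[OF holo] z by (simp add: continuous_on_eq_continuous_at)
    then show "r \<midarrow>z\<rightarrow> r z"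
      by (simp add: isCont_def)
    have "(\<lambda>w. poly p w / poly q w) \<midarrow>z\<rightarrow> poly p z / poly q z"
      using q_nz z by (intro tendsto_intros) auto
    moreover have "\<forall>\<^sub>F w in at z. poly p w / poly q w = r w"
      using eventually_not_in_finite[OF T, of z] by eventually_elim (simp add: r_eq)
    ultimately show "r \<midarrow>z\<rightarrow> poly p z / poly q z"
      by (rule Lim_transform_eventually)
  qed
  then show ?thesis
    using that q_nz T unfolding T_def by blast
qed

lemma radial_limit_rational:
  assumes "\<And>z. cmod z \<le> 1 \<Longrightarrow> poly q z \<noteq> 0"
    and "\<And>z. cmod z < 1 \<Longrightarrow> r z = poly p z / poly q z"
  shows "radial_limit r (cis t) = poly p (cis t) / poly q (cis t)"
  unfolding radial_limit_def
proof (rule tendsto_Lim)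
  have "((\<lambda>x::real. poly p (of_real x * cis t) / poly q (of_real x * cis t))
      \<longlongrightarrow> poly p (of_real 1 * cis t) / poly q (of_real 1 * cis t)) (at_left 1)"
    using assms(1) by (intro tendsto_intros) auto
  moreover have "\<forall>\<^sub>F x::real in at_left 1. x \<in> {0<..<1}"
    by (rule eventually_at_leftI[of 0]) auto
  then have "\<forall>\<^sub>F x::real in at_left 1.
      poly p (of_real x * cis t) / poly q (of_real x * cis t) = r (of_real x * cis t)"
    by eventually_elim (use assms(2) in \<open>simp add: norm_mult\<close>)
  ultimately show "((\<lambda>x::real. r (of_real x * cis t)) \<longlongrightarrow> poly p (cis t) / poly q (cis t)) (at_left 1)"
    by (simp add: Lim_transform_eventually)
qed simp

text \<open>A nonempty open set has positive measure. Thus the identity almost everywhere on the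
  circle becomes one at every point, since the rational boundary functions are continuous.\<close>

lemma AE_lborel_continuous_eq:
  fixes f :: "real \<Rightarrow> real"
  assumes "AE t in lborel. f t = c" "continuous_on UNIV f"
  shows "f x = c"
proof (rule ccontr)
  assume "f x \<noteq> c"
  define U where "U = {t. f t \<noteq> c}"
  have "U = f -` (- {c})"
    by (auto simp: U_def)
  then have "open U"
    using assms(2) by (simp add: open_vimage open_Compl)
  then obtain e where e: "e > 0" "ball x e \<subseteq> U"
    using \<open>f x \<noteq> c\<close> unfolding open_contains_ball U_def by blast
  have U: "U \<in> sets lborel"
    using \<open>open U\<close> by simp
  then have "emeasure lborel U = 0"
    using assms(1) by (subst (asm) AE_iff_measurable[of U]) (auto simp: U_def)
  moreover have "emeasure lborel (ball x e) \<le> emeasure lborel U"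
    using e(2) U by (rule emeasure_mono)
  moreover have "ball x e = {x - e<..<x + e}"
    by (auto simp: dist_real_def)
  ultimately show False
    using e(1) by simp
qed

text \<open>An outer function is a unimodular constant times an exponential. This is what keeps the
  zeros of \<open>A\<close> out of the open disk.\<close>

lemma outer_nonzero: "outer f \<Longrightarrow> cmod z < 1 \<Longrightarrow> f z \<noteq> 0"
  unfolding outer_def by force

lemma rational_pythagorean_pair_polys:
  assumes "rational_pythagorean_pair b a"
  obtains A B Q where "pythagorean_polys A B Q"
    "\<And>z. cmod z < 1 \<Longrightarrow> b z = poly B z / poly Q z"
    "\<And>z. cmod z < 1 \<Longrightarrow> b z / a z = poly B z / poly A z"
    "finite {z. b z / a z \<noteq> poly B z / poly A z}"
proof -
  have pair: "b \<in> hardy_inf" "a \<in> hardy_inf" "rational_function b" "rational_function a" "outer a"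
    "AE t in lborel. (cmod (radial_limit b (cis t)))\<^sup>2 + (cmod (radial_limit a (cis t)))\<^sup>2 = 1"
    using assms by (auto simp: rational_pythagorean_pair_def pythagorean_pair_def)
  obtain pb qb where qb: "\<And>z. cmod z \<le> 1 \<Longrightarrow> poly qb z \<noteq> 0"
    and b: "\<And>z. cmod z < 1 \<Longrightarrow> b z = poly pb z / poly qb z" "finite {z. b z \<noteq> poly pb z / poly qb z}"
    by (rule bounded_rational_function[OF pair(1,3)]) (rule that; blast)
  obtain pa qa where qa: "\<And>z. cmod z \<le> 1 \<Longrightarrow> poly qa z \<noteq> 0"
    and a: "\<And>z. cmod z < 1 \<Longrightarrow> a z = poly pa z / poly qa z" "finite {z. a z \<noteq> poly pa z / poly qa z}"
    by (rule bounded_rational_function[OF pair(2,4)]) (rule that; blast)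
  define g where "g t = (cmod (poly pb (cis t) / poly qb (cis t)))\<^sup>2 + (cmod (poly pa (cis t) / poly qa (cis t)))\<^sup>2" for t
  have "AE t in lborel. g t = 1"
    using pair(6) by (simp add: g_def radial_limit_rational[OF qb b(1)] radial_limit_rational[OF qa a(1)])
  moreover have "continuous_on UNIV g"
    unfolding g_def using qa qb by (intro continuous_intros) auto
  ultimately have g: "g t = 1" for t
    by (rule AE_lborel_continuous_eq)
  \<comment> \<open>Over the common denominator \<open>qa * qb\<close> the functions
    \<open>a\<close> and \<open>b\<close> have the numerators \<open>pa * qb\<close> and
    \<open>pb * qa\<close>.\<close>
  have polys: "pythagorean_polys (pa * qb) (pb * qa) (qa * qb)"
  proof
    fix z :: complex
    assume "cmod z < 1"
    then show "poly (pa * qb) z \<noteq> 0"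
      using outer_nonzero[OF pair(5), of z] a(1)[of z] qb[of z] by auto
  next
    fix z :: complex
    assume "cmod z \<le> 1"
    then show "poly (qa * qb) z \<noteq> 0"
      using qa qb by simp
  next
    fix z :: complex
    assume "cmod z = 1"
    then obtain t where z: "z = cis t"
      using complex_norm_eq_1_exp[of z] by (metis cis_conv_exp)
    have "poly qa z \<noteq> 0" "poly qb z \<noteq> 0"
      using qa qb by (simp_all add: z)
    then show "(cmod (poly (pb * qa) z))\<^sup>2 + (cmod (poly (pa * qb) z))\<^sup>2 = (cmod (poly (qa * qb) z))\<^sup>2"
      using g[of t] by (simp add: g_def z norm_mult norm_divide power_mult_distrib power_divide field_simps)
  qed
  have "qa \<noteq> 0" "qb \<noteq> 0"
    using qa[of 0] qb[of 0] by auto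
  \<comment> \<open>At a zero of \<open>pa\<close> outside the listed sets both quotients are 0, as
    division by zero gives 0.\<close>
  have "finite {z. b z / a z \<noteq> poly (pb * qa) z / poly (pa * qb) z}"
  proof (rule finite_subset)
    show "{z. b z / a z \<noteq> poly (pb * qa) z / poly (pa * qb) z}
        \<subseteq> {z. b z \<noteq> poly pb z / poly qb z} \<union> {z. a z \<noteq> poly pa z / poly qa z}
          \<union> {z. poly qa z = 0} \<union> {z. poly qb z = 0}"
      by (auto simp: mult_ac)
    show "finite ({z. b z \<noteq> poly pb z / poly qb z} \<union> {z. a z \<noteq> poly pa z / poly qa z}
          \<union> {z. poly qa z = 0} \<union> {z. poly qb z = 0})"
      using a(2) b(2) \<open>qa \<noteq> 0\<close> \<open>qb \<noteq> 0\<close> by (simp add: poly_roots_finite)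
  qed
  moreover have "b z = poly (pb * qa) z / poly (qa * qb) z"
    "b z / a z = poly (pb * qa) z / poly (pa * qb) z" if "cmod z < 1" for z
    using that a(1)[of z] b(1)[of z] qa[of z] qb[of z] by (simp_all add: mult_ac)
  ultimately show ?thesis
    using that[OF polys] by blast
qed

section \<open>Poles of \<phi> and zeros of \<open>A\<close>\<close>

context
  fixes A B :: "complex poly" and \<phi> :: "complex \<Rightarrow> complex" and \<zeta> :: complex
  assumes eq: "finite {z. \<phi> z \<noteq> poly B z / poly A z}" and A: "A \<noteq> 0" and B: "poly B \<zeta> \<noteq> 0"
begin

lemma eventually_eq_rational: "\<forall>\<^sub>F z in at \<zeta>. \<phi> z = poly B z / poly A z"
  using eventually_not_in_finite[OF eq, of \<zeta>] by simp

lemma is_pole_rational_iff: "is_pole \<phi> \<zeta> \<longleftrightarrow> poly A \<zeta> = 0"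
proof -
  have "is_pole \<phi> \<zeta> \<longleftrightarrow> is_pole (\<lambda>z. poly B z / poly A z) \<zeta>"
    by (rule is_pole_cong[OF eventually_eq_rational refl])
  also have "\<dots> \<longleftrightarrow> poly A \<zeta> = 0"
  proof
    assume "poly A \<zeta> = 0"
    moreover have "\<forall>\<^sub>F z in at \<zeta>. poly A z \<noteq> 0"
      using eventually_not_in_finite[OF poly_roots_finite[OF A], of \<zeta>] by simp
    moreover have "poly A \<midarrow>\<zeta>\<rightarrow> poly A \<zeta>"
      by (intro tendsto_intros)
    ultimately have "filterlim (poly A) (at 0) (at \<zeta>)"
      by (simp add: filterlim_at)
    then show "is_pole (\<lambda>z. poly B z / poly A z) \<zeta>"
      using B by (intro is_pole_divide) auto
  next
    assume pole: "is_pole (\<lambda>z. poly B z / poly A z) \<zeta>"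
    show "poly A \<zeta> = 0"
    proof (rule ccontr)
      assume "poly A \<zeta> \<noteq> 0"
      then have "(\<lambda>z. poly B z / poly A z) \<midarrow>\<zeta>\<rightarrow> poly B \<zeta> / poly A \<zeta>"
        by (intro tendsto_intros)
      then show False
        using pole not_tendsto_and_filterlim_at_infinity[of "at \<zeta>"] unfolding is_pole_def by auto
    qed
  qed
  finally show ?thesis .
qed

lemma zorder_rational: "zorder \<phi> \<zeta> = - int (order \<zeta> A)"
proof -
  define n where "n = order \<zeta> A"
  obtain R where R: "A = [:- \<zeta>, 1:] ^ n * R" "\<not> [:- \<zeta>, 1:] dvd R"
    using order_decomp[OF A] unfolding n_def by blast
  have R\<zeta>: "poly R \<zeta> \<noteq> 0"
    using R(2) by (simp add: poly_eq_0_iff_dvd)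
  then have "R \<noteq> 0"
    by auto
  \<comment> \<open>\<zeta> is taken out of the exceptional set so that \<open>- T\<close> is an
    open neighbourhood of it; the value of \<phi> at \<zeta> itself does not affect the
    order.\<close>
  define T where "T = ({z. \<phi> z \<noteq> poly B z / poly A z} \<union> {z. poly R z = 0}) - {\<zeta>}"
  have T: "finite T"
    using eq poly_roots_finite[OF \<open>R \<noteq> 0\<close>] by (simp add: T_def)
  show ?thesis
    unfolding n_def[symmetric]
  proof (rule zorder_eqI[of "- T" _ "\<lambda>z. poly B z / poly R z"])
    show "open (- T)"
      using T by (simp add: finite_imp_closed open_Compl)
    show "(\<lambda>z. poly B z / poly R z) holomorphic_on - T"
      using R\<zeta> by (intro holomorphic_intros) (auto simp: T_def)
    show "\<phi> w = poly B w / poly R w * (w - \<zeta>) powi (- int n)" if "w \<in> - T" "w \<noteq> \<zeta>" for w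
    proof -
      have "\<phi> w = poly B w / poly A w"
        using that by (auto simp: T_def)
      also have "poly A w = (w - \<zeta>) ^ n * poly R w"
        by (simp add: R(1) poly_power)
      finally show ?thesis
        by (simp add: power_int_minus divide_inverse mult_ac)
    qed
  qed (use B R\<zeta> in \<open>auto simp: T_def\<close>)
qed

end

section \<open>Translation into formal power series and conclusion\<close>

lemma taylor_coeff_eq: "taylor_coeff f n = fps_expansion f 0 $ n"
  by (simp add: taylor_coeff_def fps_expansion_def)

lemma corr_square_summable_iff:
  "corr_square_summable \<phi> f \<longleftrightarrow>
    (\<exists>G. l2_fps G \<and> corr_sums (fps_expansion \<phi> 0) (fps_expansion f 0) G)" (is "?L \<longleftrightarrow> ?R")
proof
  assume ?L
  then have "corr_sums (fps_expansion \<phi> 0) (fps_expansion f 0) (Abs_fps (\<lambda>m. \<Sum>n. corr_term \<phi> f m n))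
      \<and> l2_fps (Abs_fps (\<lambda>m. \<Sum>n. corr_term \<phi> f m n))"
    by (auto simp: corr_square_summable_def corr_sums_def l2_fps_def corr_term_def[abs_def]
        taylor_coeff_eq summable_sums)
  then show ?R
    by blast
next
  assume ?R
  then obtain G where G: "l2_fps G" "\<And>m. corr_term \<phi> f m sums (G $ m)"
    by (auto simp: corr_sums_def corr_term_def[abs_def] taylor_coeff_eq)
  then show ?L
    using sums_summable[OF G(2)] sums_unique[OF G(2)]
    by (simp add: corr_square_summable_def l2_fps_def)
qed

lemma corr_norm_formula_iff:
  assumes "l2_fps (fps_expansion f 0)" "l2_fps G" "corr_sums (fps_expansion \<phi> 0) (fps_expansion f 0) G"
  shows "corr_norm_formula \<phi> ip f \<longleftrightarrow> (ip_norm ip f)\<^sup>2 = l2_sq (fps_expansion f 0) + l2_sq G"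
proof -
  have "(\<Sum>n. corr_term \<phi> f m n) = G $ m" for m
    using assms(3) by (auto simp: corr_sums_def corr_term_def[abs_def] taylor_coeff_eq sums_iff)
  then show ?thesis
    using assms corr_square_summable_iff
    by (auto simp: corr_norm_formula_def l2_fps_def l2_sq_def taylor_coeff_eq)
qed

theorem theorem5p1:
  fixes b a \<phi> :: "complex \<Rightarrow> complex"
    and H :: "(complex \<Rightarrow> complex) set"
    and ip :: "(complex \<Rightarrow> complex) \<Rightarrow> (complex \<Rightarrow> complex) \<Rightarrow> complex"
  assumes pair: "rational_pythagorean_pair b a"
    and phi: "\<phi> = (\<lambda>z. b z / a z)"
    and space: "is_dbr_space b H ip"
  shows "(\<forall>f. f \<in> hardy 2 \<and> corr_square_summable \<phi> f \<longrightarrow>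
            f \<in> H \<and> corr_norm_formula \<phi> ip f) \<and>
         ((\<forall>\<zeta>. cmod \<zeta> = 1 \<and> is_pole \<phi> \<zeta> \<longrightarrow> zorder \<phi> \<zeta> = -1) \<longrightarrow>
            (\<forall>f\<in>H. corr_square_summable \<phi> f)) \<and>
         ((\<exists>\<zeta>. cmod \<zeta> = 1 \<and> is_pole \<phi> \<zeta> \<and> zorder \<phi> \<zeta> \<le> -2) \<longrightarrow>
            (\<exists>f\<in>H. (\<exists>m. \<not> summable (corr_term \<phi> f m)) \<and>
               \<not> corr_square_summable \<phi> f \<and> \<not> corr_norm_formula \<phi> ip f))"
proof -
  obtain A B Q where polys: "pythagorean_polys A B Q"
    and b: "\<And>z. cmod z < 1 \<Longrightarrow> b z = poly B z / poly Q z"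
    and disk: "\<And>z. cmod z < 1 \<Longrightarrow> b z / a z = poly B z / poly A z"
    and fin: "finite {z. b z / a z \<noteq> poly B z / poly A z}"
    by (rule rational_pythagorean_pair_polys[OF pair]) (rule that; blast)
  have \<phi>_disk: "\<phi> z = poly B z / poly A z" if "cmod z < 1" for z
    using disk[OF that] by (simp add: phi)
  have \<phi>_fin: "finite {z. \<phi> z \<noteq> poly B z / poly A z}"
    using fin by (simp add: phi)
  interpret pythagorean_polys A B Q
    by fact
  have A0: "A \<noteq> 0"
    using A_nonzero[of 0] by auto
  have "\<phi> has_fps_expansion \<Phi>"
    unfolding has_fps_expansion_def
  proof
    have "ereal 1 \<le> fps_conv_radius \<Phi>"
      by (rule inverse_poly_fps(1)[OF A_nonzero])
    then show "0 < fps_conv_radius \<Phi>"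
      by (rule less_le_trans[rotated]) simp
    have "\<forall>\<^sub>F z in nhds 0. z \<in> (unit_disk :: complex set)"
      by (intro eventually_nhds_in_open) auto
    then show "\<forall>\<^sub>F z in nhds 0. eval_fps \<Phi> z = \<phi> z"
      by eventually_elim (simp add: eval_\<Phi> \<phi>_disk)
  qed
  then have \<phi>_exp: "fps_expansion \<phi> 0 = \<Phi>"
    by (rule fps_expansion_eqI)
  have "f \<in> H \<and> corr_norm_formula \<phi> ip f" if f: "f \<in> hardy 2" "corr_square_summable \<phi> f" for f
  proof -
    obtain G where G: "l2_fps G" "corr_sums \<Phi> (fps_expansion f 0) G"
      using f(2) unfolding corr_square_summable_iff \<phi>_exp by blast
    have "f holomorphic_on unit_disk"
      using f(1) by (simp add: hardy_def)
    then have "f z = eval_fps (fps_expansion f 0) z" if "cmod z < 1" for z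
      using has_fps_expansion_imp_eval_fps_eq[OF hardy_2_l2(1)[OF f(1)] that] by simp
    then have "dbr_rep f (fps_expansion f 0) G"
      using dbr_rep_if_corr_sums hardy_2_l2(2)[OF f(1)] G by blast
    from dbr_space_repI[OF space b this] show ?thesis
      using corr_norm_formula_iff[of f G \<phi> ip] hardy_2_l2(2)[OF f(1)] G by (simp add: \<phi>_exp)
  qed
  moreover have "corr_square_summable \<phi> f"
    if simple: "\<forall>\<zeta>. cmod \<zeta> = 1 \<and> is_pole \<phi> \<zeta> \<longrightarrow> zorder \<phi> \<zeta> = -1" and f: "f \<in> H" for f
  proof -
    obtain F G where rep: "dbr_rep f F G"
      using dbr_space_repD[OF space b f] by blast
    have "\<not> [:- \<zeta>, 1:]\<^sup>2 dvd A" if \<zeta>: "cmod \<zeta> = 1" for \<zeta>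
    proof
      assume dvd: "[:- \<zeta>, 1:]\<^sup>2 dvd A"
      then have root: "poly A \<zeta> = 0"
        by (auto elim!: dvdE)
      note B\<zeta> = B_nonzero_at_root[OF \<zeta> root]
      have "order \<zeta> A = 1"
        using simple \<zeta> is_pole_rational_iff[OF \<phi>_fin A0 B\<zeta>] root zorder_rational[OF \<phi>_fin A0 B\<zeta>] by auto
      then show False
        using dvd A0 by (simp add: order_divides)
    qed
    from corr_sums_if_dbr_rep[OF this rep] show ?thesis
      unfolding corr_square_summable_iff \<phi>_exp dbr_rep_fps_expansion(2)[OF rep] .
  qed
  moreover have "\<exists>f\<in>H. (\<exists>m. \<not> summable (corr_term \<phi> f m)) \<and>
      \<not> corr_square_summable \<phi> f \<and> \<not> corr_norm_formula \<phi> ip f"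
    if \<zeta>: "cmod \<zeta> = 1" "is_pole \<phi> \<zeta>" "zorder \<phi> \<zeta> \<le> -2" for \<zeta>
  proof -
    \<comment> \<open>If \<open>A\<close> did not vanish at \<zeta>, \<phi> would have a finite
      limit there and no pole. So \<zeta> is a zero of \<open>A\<close> on the circle, where
      \<open>B\<close> is nonzero.\<close>
    have B\<zeta>: "poly B \<zeta> \<noteq> 0"
    proof (cases "poly A \<zeta> = 0")
      case True
      then show ?thesis
        using B_nonzero_at_root \<zeta>(1) by blast
    next
      case False
      have "(\<lambda>z. poly B z / poly A z) \<midarrow>\<zeta>\<rightarrow> poly B \<zeta> / poly A \<zeta>"
        using False by (intro tendsto_intros)
      moreover have "\<forall>\<^sub>F z in at \<zeta>. poly B z / poly A z = \<phi> z"
        using eventually_not_in_finite[OF \<phi>_fin, of \<zeta>] by eventually_elim simp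
      ultimately have "\<phi> \<midarrow>\<zeta>\<rightarrow> poly B \<zeta> / poly A \<zeta>"
        by (rule Lim_transform_eventually)
      then show ?thesis
        using \<zeta>(2) not_tendsto_and_filterlim_at_infinity[of "at \<zeta>"] unfolding is_pole_def by auto
    qed
    have "2 \<le> order \<zeta> A"
      using zorder_rational[OF \<phi>_fin A0 B\<zeta>] \<zeta>(3) by simp
    then have "[:- \<zeta>, 1:]\<^sup>2 dvd A"
      by (simp add: order_divides)
    then obtain F G where rep: "dbr_rep (eval_fps F) F G" "\<not> summable (\<lambda>n. cnj (\<Phi> $ n) * F $ n)"
      using exists_divergent[OF \<zeta>(1)] by blast
    \<comment> \<open>The divergence occurs already for \<open>m = 0\<close>.\<close>
    have "\<not> summable (corr_term \<phi> (eval_fps F) 0)"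
      using rep(2) by (simp add: corr_term_def[abs_def] taylor_coeff_eq \<phi>_exp dbr_rep_fps_expansion(2)[OF rep(1)])
    then show ?thesis
      using dbr_space_repI(1)[OF space b rep(1)]
      unfolding corr_norm_formula_def corr_square_summable_def by blast
  qed
  ultimately show ?thesis
    by blast
qed

end
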